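(* For each of the following problems on graphs: maximum independent set, maximum cut, minimum vertex cover, minimum dominating set, the following holds. There is a universal constant $0<\varepsilon_0<1$ such that for every $0<\varepsilon\le\varepsilon_0$, any randomized $\mathsf{LOCAL}$ algorithm $\mathcal{A}$ whose output is always a feasible solution and whose expected solution value is within a $1\pm\varepsilon$ factor of the optimum (i.e. at least $(1-\varepsilon)\mathrm{OPT}$ for the maximization problems and at most $(1+\varepsilon)\mathrm{OPT}$ for the minimization problems) on every $n$-vertex input graph has round complexity $\Omega\left(\frac{\log n}{\varepsilon}\right)$.
   Context: The $\mathsf{LOCAL}$ model on an $n$-vertex graph $G$: synchronous rounds; in each round every vertex receives messages from its neighbours, performs arbitrary local computation and sends arbitrarily large messages to its neighbours; in the randomized variant vertices are anonymous and have independent local random bits. Here the exact number of vertices $n$ is known to all vertices. For maximum independent set, minimum vertex cover and minimum dominating set each vertex outputs whether it belongs to the solution set; for maximum cut (finding a bipartition $V=S\cup T$ maximizing the number of crossing edges) each edge decides whether it belongs to the cut. *)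

theory Defs
  imports "HOL-Probability.Probability"
begin

section \<open>Graphs\<close>

text \<open>
  An \<open>n\<close>-vertex graph has vertex set \<open>{..<n}\<close> and a set \<open>E\<close> of two-element subsets of it as edges.
  Vertex names serve the description of an execution only; algorithms never see them.
\<close>

definition simple_graph :: "nat \<Rightarrow> nat set set \<Rightarrow> bool" where
  "simple_graph n E \<longleftrightarrow> (\<forall>e\<in>E. e \<subseteq> {..<n} \<and> card e = 2)"

definition nbrs :: "nat set set \<Rightarrow> nat \<Rightarrow> nat set" where
  "nbrs E v = {u. {u, v} \<in> E}"

definition deg :: "nat set set \<Rightarrow> nat \<Rightarrow> nat" where
  "deg E v = card (nbrs E v)"

section \<open>The randomized LOCAL model\<close>

text \<open>
  A vertex \<open>v\<close> addresses its neighbours through local ports \<open>0, \<dots>, deg v - 1\<close>; \<open>p v i\<close> is the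
  neighbour behind port \<open>i\<close>. The numbering carries no global information and is chosen
  adversarially: guarantees of an algorithm are required for all numberings.
\<close>

definition port_numbering :: "nat \<Rightarrow> nat set set \<Rightarrow> (nat \<Rightarrow> nat \<Rightarrow> nat) \<Rightarrow> bool" where
  "port_numbering n E p \<longleftrightarrow> (\<forall>v<n. bij_betw (p v) {..<deg E v} (nbrs E v))"

definition port_towards :: "nat set set \<Rightarrow> (nat \<Rightarrow> nat \<Rightarrow> nat) \<Rightarrow> nat \<Rightarrow> nat \<Rightarrow> nat" where
  "port_towards E p u v = (THE j. j < deg E u \<and> p u j = v)"

text \<open>
  Local states and messages are taken from one fixed type, so that constants may be quantified
  outside of all algorithms. It contains numbers and random bit sequences and is closed under
  finite lists. Hence it can hold the complete history of a vertex, and an algorithm with any other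
  types of states and messages can be simulated round by round by one that forwards its
  complete history.
\<close>

type_synonym bits = "nat \<Rightarrow> bool"

datatype datum = Num nat | Bits bits | Lst "datum list"

text \<open>
  \<open>init\<close> receives the number of vertices, the degree of the vertex and its private random bits.
  \<open>send s i\<close> is the message that a vertex in state \<open>s\<close> sends through port \<open>i\<close>. \<open>receive s ms\<close> is the
  new state after obtaining the messages \<open>ms\<close>, listed by port. All vertices produce their outputs
  after \<open>rounds n\<close> rounds. The functions are arbitrary and identical at all vertices.
\<close>

record 'o local_alg =
  rounds :: "nat \<Rightarrow> nat"
  init :: "nat \<Rightarrow> nat \<Rightarrow> bits \<Rightarrow> datum"
  send :: "datum \<Rightarrow> nat \<Rightarrow> datum"
  receive :: "datum \<Rightarrow> datum list \<Rightarrow> datum"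
  outcome :: "datum \<Rightarrow> 'o"

primrec state_after ::
    "'o local_alg \<Rightarrow> nat \<Rightarrow> nat set set \<Rightarrow> (nat \<Rightarrow> nat \<Rightarrow> nat) \<Rightarrow> (nat \<Rightarrow> bits) \<Rightarrow> nat \<Rightarrow> nat \<Rightarrow> datum"
where
  "state_after A n E p w 0 = (\<lambda>v. init A n (deg E v) (w v))"
| "state_after A n E p w (Suc t) = (\<lambda>v.
     receive A (state_after A n E p w t v)
       (map (\<lambda>i. send A (state_after A n E p w t (p v i)) (port_towards E p (p v i) v))
         [0..<deg E v]))"

definition final_output ::
    "'o local_alg \<Rightarrow> nat \<Rightarrow> nat set set \<Rightarrow> (nat \<Rightarrow> nat \<Rightarrow> nat) \<Rightarrow> (nat \<Rightarrow> bits) \<Rightarrow> nat \<Rightarrow> 'o" where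
  "final_output A n E p w v = outcome A (state_after A n E p w (rounds A n) v)"

text \<open>Every vertex has an infinite sequence of fair coin flips, all of them independent.\<close>

definition random_bits :: "nat \<Rightarrow> (nat \<Rightarrow> bits) measure" where
  "random_bits n = (\<Pi>\<^sub>M v\<in>{..<n}. \<Pi>\<^sub>M i\<in>(UNIV :: nat set). measure_pmf (bernoulli_pmf (1/2)))"

text \<open>In vertex problems every vertex outputs whether it belongs to the solution.\<close>

definition vertex_solution ::
    "bool local_alg \<Rightarrow> nat \<Rightarrow> nat set set \<Rightarrow> (nat \<Rightarrow> nat \<Rightarrow> nat) \<Rightarrow> (nat \<Rightarrow> bits) \<Rightarrow> nat set" where
  "vertex_solution A n E p w = {v. v < n \<and> final_output A n E p w v}"

text \<open>
  In edge problems every vertex outputs for each of its ports whether the edge behind it belongs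
  to the solution. The decision of an edge is well-defined if its two endpoints agree on it.
\<close>

definition edge_agreement ::
    "(nat \<Rightarrow> bool) local_alg \<Rightarrow> nat \<Rightarrow> nat set set \<Rightarrow> (nat \<Rightarrow> nat \<Rightarrow> nat) \<Rightarrow> (nat \<Rightarrow> bits) \<Rightarrow> bool" where
  "edge_agreement A n E p w \<longleftrightarrow> (\<forall>v<n. \<forall>i<deg E v.
     final_output A n E p w v i = final_output A n E p w (p v i) (port_towards E p (p v i) v))"

definition edge_solution ::
    "(nat \<Rightarrow> bool) local_alg \<Rightarrow> nat \<Rightarrow> nat set set \<Rightarrow> (nat \<Rightarrow> nat \<Rightarrow> nat) \<Rightarrow> (nat \<Rightarrow> bits)
      \<Rightarrow> nat set set" where
  "edge_solution A n E p w = {{v, p v i} | v i. v < n \<and> i < deg E v \<and> final_output A n E p w v i}"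

section \<open>Optimization problems\<close>

definition independent_set :: "nat \<Rightarrow> nat set set \<Rightarrow> nat set \<Rightarrow> bool" where
  "independent_set n E I \<longleftrightarrow> I \<subseteq> {..<n} \<and> (\<forall>e\<in>E. \<not> e \<subseteq> I)"

definition vertex_cover :: "nat \<Rightarrow> nat set set \<Rightarrow> nat set \<Rightarrow> bool" where
  "vertex_cover n E C \<longleftrightarrow> C \<subseteq> {..<n} \<and> (\<forall>e\<in>E. e \<inter> C \<noteq> {})"

definition dominating_set :: "nat \<Rightarrow> nat set set \<Rightarrow> nat set \<Rightarrow> bool" where
  "dominating_set n E D \<longleftrightarrow> D \<subseteq> {..<n} \<and> (\<forall>v<n. v \<in> D \<or> (\<exists>u\<in>D. {u, v} \<in> E))"

definition is_cut :: "nat \<Rightarrow> nat set set \<Rightarrow> nat set set \<Rightarrow> bool" where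
  "is_cut n E F \<longleftrightarrow> (\<exists>S T. S \<union> T = {..<n} \<and> S \<inter> T = {} \<and>
     F = {e \<in> E. e \<inter> S \<noteq> {} \<and> e \<inter> T \<noteq> {}})"

definition max_value :: "('x set \<Rightarrow> bool) \<Rightarrow> nat" where
  "max_value feasible = Max (card ` {X. feasible X})"

definition min_value :: "('x set \<Rightarrow> bool) \<Rightarrow> nat" where
  "min_value feasible = Min (card ` {X. feasible X})"

section \<open>Approximation in expectation\<close>

text \<open>
  Local computation may depend on random bits arbitrarily, so it has to be demanded that the
  output is a random variable: expected values are meaningless otherwise.
\<close>

definition random_set :: "'w measure \<Rightarrow> ('w \<Rightarrow> 'x set) \<Rightarrow> bool" where
  "random_set M X \<longleftrightarrow> (\<forall>x. {w \<in> space M. x \<in> X w} \<in> sets M)"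

definition expected_size :: "'w measure \<Rightarrow> ('w \<Rightarrow> 'x set) \<Rightarrow> real" where
  "expected_size M X = (\<integral>w. real (card (X w)) \<partial>M)"

definition approx_max_independent_set :: "real \<Rightarrow> nat \<Rightarrow> bool local_alg \<Rightarrow> bool" where
  "approx_max_independent_set \<epsilon> n A \<longleftrightarrow> (\<forall>E p. simple_graph n E \<and> port_numbering n E p \<longrightarrow>
     random_set (random_bits n) (vertex_solution A n E p) \<and>
     (\<forall>w\<in>space (random_bits n). independent_set n E (vertex_solution A n E p w)) \<and>
     expected_size (random_bits n) (vertex_solution A n E p)
       \<ge> (1 - \<epsilon>) * max_value (independent_set n E))"

definition approx_max_cut :: "real \<Rightarrow> nat \<Rightarrow> (nat \<Rightarrow> bool) local_alg \<Rightarrow> bool" where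
  "approx_max_cut \<epsilon> n A \<longleftrightarrow> (\<forall>E p. simple_graph n E \<and> port_numbering n E p \<longrightarrow>
     random_set (random_bits n) (edge_solution A n E p) \<and>
     (\<forall>w\<in>space (random_bits n).
        edge_agreement A n E p w \<and> is_cut n E (edge_solution A n E p w)) \<and>
     expected_size (random_bits n) (edge_solution A n E p) \<ge> (1 - \<epsilon>) * max_value (is_cut n E))"

definition approx_min_vertex_cover :: "real \<Rightarrow> nat \<Rightarrow> bool local_alg \<Rightarrow> bool" where
  "approx_min_vertex_cover \<epsilon> n A \<longleftrightarrow> (\<forall>E p. simple_graph n E \<and> port_numbering n E p \<longrightarrow>
     random_set (random_bits n) (vertex_solution A n E p) \<and>
     (\<forall>w\<in>space (random_bits n). vertex_cover n E (vertex_solution A n E p w)) \<and>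
     expected_size (random_bits n) (vertex_solution A n E p)
       \<le> (1 + \<epsilon>) * min_value (vertex_cover n E))"

definition approx_min_dominating_set :: "real \<Rightarrow> nat \<Rightarrow> bool local_alg \<Rightarrow> bool" where
  "approx_min_dominating_set \<epsilon> n A \<longleftrightarrow> (\<forall>E p. simple_graph n E \<and> port_numbering n E p \<longrightarrow>
     random_set (random_bits n) (vertex_solution A n E p) \<and>
     (\<forall>w\<in>space (random_bits n). dominating_set n E (vertex_solution A n E p w)) \<and>
     expected_size (random_bits n) (vertex_solution A n E p)
       \<le> (1 + \<epsilon>) * min_value (dominating_set n E))"

end

(* The local views in two disjoint copies of a graph H and in its bipartite double cover agree up to
  half the odd girth of H: on a ball without odd cycles, exchanging the two layers according to a
  2-colouring is an isomorphism, and it preserves the distribution of the random bits. Hence an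
  algorithm that is too fast has the same expected solution size on both graphs, although the optima
  differ by a constant fraction of the size of H if H is far from bipartite.

  H comes from the probabilistic method. A random multigraph with n vertices and 100 n edges has many
  edges inside every set of n/4 vertices and few short odd cycles, which are destroyed by deleting
  one edge of each. This gives odd girth of order log n. Subdividing every edge into a path of length
  of order 1/epsilon multiplies the odd girth by 1/epsilon and shrinks the relative gap between the
  optima to a small multiple of epsilon. *)

theory Submission
  imports Defs "HOL-Real_Asymp.Real_Asymp"
begin

section \<open>Locally bipartite multigraphs without sparse large sets\<close>

text \<open>Equal views give only equal marginals: the exchange of layers depends on the vertex
  whose output is examined, so nothing is said about joint outputs. Expected sizes need no more than
  marginals, by linearity. As n is known, the two graphs must have equally many vertices, which
  rules out comparing H itself with its double cover; isolated vertices pad both lifts to any large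
  enough prescribed n. The gaps between the optima come from one quantity. For a set S of original
  vertices let ex(S) be card S minus the number of multigraph edges inside S. An independent set of
  the subdivided graph gains at most ex(S) from its original vertices S, a dominating set saves at
  most ex(S) by leaving out the original vertices S, and a cut with sides S and T loses at least one
  edge for every multigraph edge inside S or inside T. So the random multigraph is asked for ex(S)
  \<le> n/4 for all S, besides long odd girth. The density 100 is there to make a union bound over
  all 2^n sets work.\<close>

definition joins :: "(nat \<Rightarrow> 'a \<times> 'a) \<Rightarrow> nat \<Rightarrow> 'a \<Rightarrow> 'a \<Rightarrow> bool" where
  "joins f e x y \<longleftrightarrow> f e = (x, y) \<or> f e = (y, x)"

text \<open>A walk is the list of its edge indices, because the union bound needs distinct edges:
  these are independent coordinates of a random \<open>f\<close>, whereas vertices may repeat. The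
  order of the ends in \<open>f e\<close> is ignored here and orients the subdividing path
  later.\<close>

primrec walk :: "(nat \<Rightarrow> 'a \<times> 'a) \<Rightarrow> 'a \<Rightarrow> nat list \<Rightarrow> 'a \<Rightarrow> bool" where
  "walk f x [] y \<longleftrightarrow> x = y"
| "walk f x (e # es) y \<longleftrightarrow> (\<exists>z. joins f e x z \<and> walk f z es y)"

lemma joins_sym: "joins f e x y \<longleftrightarrow> joins f e y x"
  by (auto simp: joins_def)

lemma walk_append: "walk f x (as @ bs) y \<longleftrightarrow> (\<exists>z. walk f x as z \<and> walk f z bs y)"
  by (induction as arbitrary: x) auto

lemma walk_rev: "walk f x es y \<Longrightarrow> walk f y (rev es) x"
  by (induction es arbitrary: x) (auto simp: walk_append joins_sym)

lemma walk_map: "walk f x (map g es) y \<longleftrightarrow> walk (f \<circ> g) x es y"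
  by (induction es arbitrary: x) (auto simp: joins_def)

text \<open>A repeated edge cuts the closed walk into two shorter ones. If it is traversed twice in
  the same direction, each part keeps one copy and the lengths add up to the old length; in opposite
  directions both copies are dropped and the lengths add up to two less. Either way one part is odd.
  Thus only walks with distinct edges have to be destroyed.\<close>

lemma odd_closed_walk_distinct:
  assumes "walk f x es x" "odd (length es)"
  shows "\<exists>y es'. walk f y es' y \<and> odd (length es') \<and> distinct es' \<and> set es' \<subseteq> set es
    \<and> length es' \<le> length es"
  using assms
proof (induction es arbitrary: x rule: length_induct)
  case (1 es)
  show ?case
  proof (cases "distinct es")
    case True
    then show ?thesis using 1 by blast
  next
    case False
    then obtain as bs cs e where es: "es = as @ [e] @ bs @ [e] @ cs"
      using not_distinct_decomp by blast
    then obtain u u' w w' where w: "walk f x as u" "joins f e u u'" "walk f u' bs w"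
      "joins f e w w'" "walk f w' cs x"
      using 1(2) by (auto simp: walk_append)
    have "\<exists>y es'. walk f y es' y \<and> odd (length es') \<and> set es' \<subseteq> set es \<and> length es' < length es"
    proof (cases "u = w")
      case True
      with w have "walk f u (e # bs) u" "walk f x (as @ e # cs) x"
        by (auto simp: walk_append)
      moreover have "odd (length (e # bs)) \<or> odd (length (as @ e # cs))"
        using 1(3) es by auto
      ultimately show ?thesis
      proof (elim disjE)
        assume "walk f u (e # bs) u" "odd (length (e # bs))"
        then show ?thesis using es by (intro exI[of _ u] exI[of _ "e # bs"]) auto
      next
        assume "walk f x (as @ e # cs) x" "odd (length (as @ e # cs))"
        then show ?thesis using es by (intro exI[of _ x] exI[of _ "as @ e # cs"]) auto
      qed
    next
      case False
      with w(2,4) have "u = w'" "u' = w" by (auto simp: joins_def)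
      with w have "walk f u' bs u'" "walk f x (as @ cs) x"
        by (auto simp: walk_append)
      moreover have "odd (length bs) \<or> odd (length (as @ cs))"
        using 1(3) es by auto
      ultimately show ?thesis
      proof (elim disjE)
        assume "walk f u' bs u'" "odd (length bs)"
        then show ?thesis using es by (intro exI[of _ u'] exI[of _ bs]) auto
      next
        assume "walk f x (as @ cs) x" "odd (length (as @ cs))"
        then show ?thesis using es by (intro exI[of _ x] exI[of _ "as @ cs"]) auto
      qed
    qed
    then obtain y es' where y: "walk f y es' y" "odd (length es')" "set es' \<subseteq> set es"
      "length es' < length es" by blast
    from 1(1)[rule_format, OF y(4,1,2)] y(3,4) show ?thesis
      by (meson dual_order.trans less_imp_le)
  qed
qed

text \<open>\<open>vs\<close> leaves out the last vertex, so that a closed walk with k edges is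
  described by k vertices instead of k + 1. This saves the factor n that makes the expected number
  of short closed walks independent of n.\<close>

lemma walk_vertices:
  assumes "walk f x es y" "es \<noteq> []"
  shows "\<exists>vs. length vs = length es \<and> vs ! 0 = x \<and>
    (\<forall>i<length es. joins f (es ! i) (vs ! i) ((vs @ [y]) ! Suc i))"
  using assms
proof (induction es arbitrary: x)
  case (Cons e es)
  then obtain z where z: "joins f e x z" "walk f z es y" by auto
  show ?case
  proof (cases "es = []")
    case True
    with z show ?thesis by (intro exI[of _ "[x]"]) auto
  next
    case False
    from Cons.IH[OF z(2) False] obtain vs where vs: "length vs = length es" "vs ! 0 = z"
      "\<forall>i<length es. joins f (es ! i) (vs ! i) ((vs @ [y]) ! Suc i)" by blast
    have "(vs @ [y]) ! 0 = z" using vs False by (auto simp: nth_append)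
    with z vs show ?thesis
      by (intro exI[of _ "x # vs"]) (auto simp: nth_Cons split: nat.splits)
  qed
qed auto

section \<open>Random multigraphs have few short closed walks\<close>

definition multigraphs :: "nat \<Rightarrow> nat \<Rightarrow> (nat \<Rightarrow> nat \<times> nat) set" where
  "multigraphs n m = ({..<m} \<rightarrow>\<^sub>E {..<n} \<times> {..<n})"

lemma finite_multigraphs [simp]: "finite (multigraphs n m)"
  by (auto simp: multigraphs_def intro!: finite_PiE)

lemma card_multigraphs: "card (multigraphs n m) = (n ^ 2) ^ m"
  by (simp add: multigraphs_def card_PiE power2_eq_square)

text \<open>There are n^k candidate vertex sequences, and for each of them every edge of the walk
  has at most 2 of its n^2 values left. So a random multigraph contains the walk with probability at
  most (2/n)^k; the fraction is multiplied out to stay within natural numbers.\<close>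

lemma multigraphs_closed_walk_count:
  assumes "distinct es" "set es \<subseteq> {..<m}" "es \<noteq> []"
  shows "card {f \<in> multigraphs n m. \<exists>x. walk f x es x} * n ^ length es
    \<le> 2 ^ length es * (n ^ 2) ^ m"
proof -
  define k where "k = length es"
  define VS where "VS = {vs. set vs \<subseteq> {..<n} \<and> length vs = k}"
  \<comment> \<open>The two orientations of the i-th edge of the closed walk through
    \<open>vs\<close>; appending \<open>vs ! 0\<close> closes it.\<close>
  define A where "A vs i = {((vs @ [vs ! 0]) ! i, (vs @ [vs ! 0]) ! Suc i),
    ((vs @ [vs ! 0]) ! Suc i, (vs @ [vs ! 0]) ! i)}" for vs :: "nat list" and i
  define ix where "ix e = (THE i. i < k \<and> es ! i = e)" for e
  have ix: "ix (es ! i) = i" if "i < k" for i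
    unfolding ix_def using that assms(1) k_def by (intro the_equality) (auto simp: nth_eq_iff_index_eq)
  \<comment> \<open>The multigraphs that run through \<open>vs\<close> along \<open>es\<close>, as a
    product set: edges off the walk are free.\<close>
  define P where "P vs = PiE {..<m} (\<lambda>e. if e \<in> set es then A vs (ix e) else {..<n} \<times> {..<n})"
    for vs
  have sub: "{f \<in> multigraphs n m. \<exists>x. walk f x es x} \<subseteq> (\<Union>vs\<in>VS. P vs)"
  proof safe
    fix f x assume f: "f \<in> multigraphs n m" and w: "walk f x es x"
    from walk_vertices[OF w assms(3)] obtain vs where vs: "length vs = k" "vs ! 0 = x"
      "\<forall>i<k. joins f (es ! i) (vs ! i) ((vs @ [x]) ! Suc i)" unfolding k_def by blast
    have f_in: "f (es ! i) \<in> A vs i" if "i < k" for i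
      using vs that by (auto simp: A_def joins_def nth_append)
    have "vs ! i < n" if "i < k" for i
    proof -
      have "es ! i \<in> set es" using that k_def by simp
      then have "f (es ! i) \<in> {..<n} \<times> {..<n}"
        using f assms(2) by (force simp: multigraphs_def PiE_def Pi_def)
      then show ?thesis using vs that by (auto simp: joins_def)
    qed
    then have "vs \<in> VS" using vs by (auto simp: VS_def in_set_conv_nth)
    moreover have "f \<in> P vs"
      unfolding P_def
    proof (rule PiE_I)
      fix e assume "e \<in> {..<m}"
      show "f e \<in> (if e \<in> set es then A vs (ix e) else {..<n} \<times> {..<n})"
      proof (cases "e \<in> set es")
        case True
        then obtain i where "i < k" "e = es ! i" by (auto simp: in_set_conv_nth k_def)
        then show ?thesis using f_in[of i] ix[of i] True by simp
      next
        case False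
        then show ?thesis using f \<open>e \<in> {..<m}\<close> by (auto simp: multigraphs_def PiE_def Pi_def)
      qed
    next
      fix e assume "e \<notin> {..<m}"
      then show "f e = undefined" using f by (auto simp: multigraphs_def PiE_def extensional_def)
    qed
    ultimately show "f \<in> (\<Union>vs\<in>VS. P vs)" by blast
  qed
  have fP: "finite (P vs)" for vs
    unfolding P_def by (intro finite_PiE) (auto simp: A_def)
  have finVS: "finite VS" and cVS: "card VS = n ^ k"
    unfolding VS_def using finite_lists_length_eq[of "{..<n}" k] card_lists_length_eq[of "{..<n}" k]
    by auto
  have km: "k \<le> m" and cs: "card (set es) = k"
    using card_mono[OF _ assms(2)] distinct_card[OF assms(1)] by (auto simp: k_def)
  have cP: "card (P vs) \<le> 2 ^ k * (n ^ 2) ^ (m - k)" for vs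
  proof -
    have "card (P vs) = (\<Prod>e<m. card (if e \<in> set es then A vs (ix e) else {..<n} \<times> {..<n}))"
      unfolding P_def by (rule card_PiE) simp
    also have "\<dots> \<le> (\<Prod>e<m. if e \<in> set es then 2 else n ^ 2)"
    proof (rule prod_mono)
      fix e
      have "card {p, p'} \<le> 2" for p p' :: "nat \<times> nat" by (simp add: card_insert_if)
      then have "card (A vs (ix e)) \<le> 2" unfolding A_def .
      then show "0 \<le> card (if e \<in> set es then A vs (ix e) else {..<n} \<times> {..<n}) \<and>
        card (if e \<in> set es then A vs (ix e) else {..<n} \<times> {..<n}) \<le> (if e \<in> set es then 2 else n ^ 2)"
        by (simp add: card_cartesian_product power2_eq_square)
    qed
    also have "\<dots> = 2 ^ k * (n ^ 2) ^ (m - k)"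
    proof -
      have "{..<m} \<inter> {e. e \<in> set es} = set es" using assms(2) by auto
      moreover have "{..<m} \<inter> - {e. e \<in> set es} = {..<m} - set es" by auto
      moreover have "card ({..<m} - set es) = m - k"
        using assms(2) cs by (subst card_Diff_subset) auto
      ultimately show ?thesis using cs
        by (subst prod.If_cases) simp_all
    qed
    finally show ?thesis .
  qed
  have "card {f \<in> multigraphs n m. \<exists>x. walk f x es x} \<le> card (\<Union>vs\<in>VS. P vs)"
    using sub finVS fP by (intro card_mono) auto
  also have "\<dots> \<le> (\<Sum>vs\<in>VS. card (P vs))" by (rule card_UN_le[OF finVS])
  also have "\<dots> \<le> (\<Sum>vs\<in>VS. 2 ^ k * (n ^ 2) ^ (m - k))" by (intro sum_mono cP)
  also have "\<dots> = n ^ k * (2 ^ k * (n ^ 2) ^ (m - k))" by (simp add: cVS)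
  finally have "card {f \<in> multigraphs n m. \<exists>x. walk f x es x} * n ^ k
    \<le> n ^ k * (2 ^ k * (n ^ 2) ^ (m - k)) * n ^ k" by simp
  also have "\<dots> = 2 ^ k * ((n ^ 2) ^ k * (n ^ 2) ^ (m - k))"
    by (simp add: power2_eq_square power_mult_distrib)
  also have "\<dots> = 2 ^ k * (n ^ 2) ^ m"
    using km by (simp flip: power_add)
  finally show ?thesis by (simp add: k_def)
qed

text \<open>Closed walks of both parities are counted, each from every starting edge and in both
  directions; a first moment bound can afford this.\<close>

definition short_cycles :: "nat \<Rightarrow> nat \<Rightarrow> (nat \<Rightarrow> nat \<times> nat) \<Rightarrow> nat list set" where
  "short_cycles m l f = {es. set es \<subseteq> {..<m} \<and> distinct es \<and> es \<noteq> [] \<and> length es \<le> l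
    \<and> (\<exists>x. walk f x es x)}"

lemma finite_short_cycles [simp]: "finite (short_cycles m l f)"
  by (rule finite_subset[OF _ finite_lists_length_le[of "{..<m}" l]]) (auto simp: short_cycles_def)

text \<open>There are at most (D n)^k lists of k edges, each closed with probability at most
  (2/n)^k, so n cancels and the mean number of short closed walks is at most a geometric sum in 2 D.
  Linearly many edges are therefore compatible with a length l of order log n.\<close>

lemma sum_short_cycles:
  assumes "n > 0" "D > 0"
  shows "(\<Sum>f\<in>multigraphs n (D * n). card (short_cycles (D * n) l f))
    \<le> (2 * D) ^ Suc l * (n ^ 2) ^ (D * n)"
proof -
  define m where "m = D * n"
  define F where "F = multigraphs n m"
  define L where "L = {es. set es \<subseteq> {..<m} \<and> distinct es \<and> es \<noteq> [] \<and> length es \<le> l}"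
  have finL: "finite L"
    by (rule finite_subset[OF _ finite_lists_length_le[of "{..<m}" l]]) (auto simp: L_def)
  define Lk where "Lk k = {es. set es \<subseteq> {..<m} \<and> length es = k}" for k
  have Lk: "finite (Lk k)" "card (Lk k) = m ^ k" for k
    using finite_lists_length_eq[of "{..<m}" k] card_lists_length_eq[of "{..<m}" k]
    by (auto simp: Lk_def)
  have "(\<Sum>f\<in>F. card (short_cycles m l f)) = (\<Sum>f\<in>F. \<Sum>es\<in>L. of_bool (\<exists>x. walk f x es x))"
  proof (intro sum.cong refl)
    fix f
    have "short_cycles m l f = L \<inter> {es. \<exists>x. walk f x es x}"
      by (auto simp: short_cycles_def L_def)
    then show "card (short_cycles m l f) = (\<Sum>es\<in>L. of_bool (\<exists>x. walk f x es x))"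
      using finL by (simp add: sum_of_bool_eq)
  qed
  also have "\<dots> = (\<Sum>es\<in>L. card {f\<in>F. \<exists>x. walk f x es x})"
  proof (subst sum.swap, intro sum.cong refl)
    fix es
    have "F \<inter> {f. \<exists>x. walk f x es x} = {f\<in>F. \<exists>x. walk f x es x}" by auto
    then show "(\<Sum>f\<in>F. of_bool (\<exists>x. walk f x es x)) = card {f\<in>F. \<exists>x. walk f x es x}"
      by (simp add: F_def sum_of_bool_eq)
  qed
  finally have eq: "real (\<Sum>f\<in>F. card (short_cycles m l f))
    = (\<Sum>es\<in>L. real (card {f\<in>F. \<exists>x. walk f x es x}))" by simp
  have "\<dots> \<le> (\<Sum>es\<in>L. 2 ^ length es * (real n ^ 2) ^ m / real n ^ length es)"
  proof (rule sum_mono)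
    fix es assume "es \<in> L"
    then have "card {f\<in>F. \<exists>x. walk f x es x} * n ^ length es \<le> 2 ^ length es * (n ^ 2) ^ m"
      unfolding F_def by (intro multigraphs_closed_walk_count) (auto simp: L_def)
    then have "real (card {f\<in>F. \<exists>x. walk f x es x} * n ^ length es)
      \<le> real (2 ^ length es * (n ^ 2) ^ m)" by (simp only: of_nat_le_iff)
    then show "real (card {f\<in>F. \<exists>x. walk f x es x})
      \<le> 2 ^ length es * (real n ^ 2) ^ m / real n ^ length es"
      using assms by (simp add: field_simps)
  qed
  also have "\<dots> \<le> (\<Sum>es\<in>(\<Union>k\<in>{..l}. Lk k). 2 ^ length es * (real n ^ 2) ^ m / real n ^ length es)"
    using Lk(1) by (intro sum_mono2) (auto simp: L_def Lk_def)
  also have "\<dots> = (\<Sum>k\<le>l. \<Sum>es\<in>Lk k. 2 ^ length es * (real n ^ 2) ^ m / real n ^ length es)"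
    using Lk(1) by (intro sum.UNION_disjoint) (auto simp: Lk_def)
  also have "\<dots> = (\<Sum>k\<le>l. real (2 * D) ^ k * (real n ^ 2) ^ m)"
  proof (intro sum.cong refl)
    fix k
    have "(\<Sum>es\<in>Lk k. 2 ^ length es * (real n ^ 2) ^ m / real n ^ length es)
      = (\<Sum>es\<in>Lk k. 2 ^ k * (real n ^ 2) ^ m / real n ^ k)"
      by (intro sum.cong) (auto simp: Lk_def)
    also have "\<dots> = real m ^ k * (2 ^ k * (real n ^ 2) ^ m / real n ^ k)"
      by (simp add: Lk)
    also have "\<dots> = real (2 * D) ^ k * (real n ^ 2) ^ m"
      using assms by (simp add: m_def power_mult_distrib)
    finally show "(\<Sum>es\<in>Lk k. 2 ^ length es * (real n ^ 2) ^ m / real n ^ length es)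
      = real (2 * D) ^ k * (real n ^ 2) ^ m" .
  qed
  also have "\<dots> = (\<Sum>k\<le>l. real (2 * D) ^ k) * (real n ^ 2) ^ m" by (simp add: sum_distrib_right)
  also have "\<dots> \<le> real (2 * D) ^ Suc l * (real n ^ 2) ^ m"
  proof (rule mult_right_mono)
    have "(\<Sum>k\<le>l. (2 * D) ^ k) \<le> (2 * D) ^ Suc l" for l
    proof (induction l)
      case (Suc l)
      have "(\<Sum>k\<le>Suc l. (2 * D) ^ k) \<le> (2 * D) ^ Suc l + (2 * D) ^ Suc l"
        using Suc unfolding sum.atMost_Suc by (rule add_right_mono)
      also have "\<dots> = 2 * (2 * D) ^ Suc l" by simp
      also have "\<dots> \<le> (2 * D) * (2 * D) ^ Suc l" using assms by (intro mult_right_mono) auto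
      finally show ?case unfolding power_Suc .
    qed (use assms in auto)
    from this[of l] have "real (\<Sum>k\<le>l. (2 * D) ^ k) \<le> real ((2 * D) ^ Suc l)"
      by (simp only: of_nat_le_iff)
    then show "(\<Sum>k\<le>l. real (2 * D) ^ k) \<le> real (2 * D) ^ Suc l"
      by (simp only: of_nat_sum of_nat_power)
  qed simp
  finally have "real (\<Sum>f\<in>F. card (short_cycles m l f)) \<le> real ((2 * D) ^ Suc l * (n ^ 2) ^ m)"
    unfolding eq by simp
  then show ?thesis unfolding of_nat_le_iff F_def m_def .
qed

section \<open>Large vertex sets span many edges\<close>

definition spanned :: "nat \<Rightarrow> (nat \<Rightarrow> 'a \<times> 'a) \<Rightarrow> 'a set \<Rightarrow> nat set" where
  "spanned m f S = {e. e < m \<and> fst (f e) \<in> S \<and> snd (f e) \<in> S}"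

lemma finite_spanned [simp]: "finite (spanned m f S)"
  by (simp add: spanned_def)

text \<open>Weighting every spanned edge by \<open>1/2\<close> makes the sum factorise over the edges; by Markov's
  inequality this exponential moment replaces a binomial tail estimate.\<close>

lemma sum_half_power_spanned:
  assumes "S \<subseteq> {..<n}"
  shows "(\<Sum>f\<in>multigraphs n m. (1/2) ^ card (spanned m f S)) = (real n ^ 2 - real (card S) ^ 2 / 2) ^ m"
proof -
  define g where "g p = (if fst p \<in> S \<and> snd p \<in> S then 1/2 else 1 :: real)" for p :: "nat \<times> nat"
  have "(\<Sum>f\<in>multigraphs n m. (1/2) ^ card (spanned m f S))
    = (\<Sum>f\<in>multigraphs n m. \<Prod>e<m. g (f e))"
  proof (intro sum.cong refl)
    fix f
    have "{..<m} \<inter> {e. fst (f e) \<in> S \<and> snd (f e) \<in> S} = spanned m f S"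
      by (auto simp: spanned_def)
    then show "(1/2) ^ card (spanned m f S) = (\<Prod>e<m. g (f e))"
      unfolding g_def by (subst prod.If_cases) auto
  qed
  also have "\<dots> = (\<Prod>e<m. \<Sum>p\<in>{..<n} \<times> {..<n}. g p)"
    unfolding multigraphs_def by (subst prod_sum_PiE) auto
  also have "(\<Sum>p\<in>{..<n} \<times> {..<n}. g p) = real n ^ 2 - real (card S) ^ 2 / 2"
  proof -
    have "g p = 1 - of_bool (p \<in> S \<times> S) / 2" for p by (cases p) (simp add: g_def)
    moreover have "({..<n} \<times> {..<n}) \<inter> S \<times> S = S \<times> S" using assms by auto
    ultimately show ?thesis
      by (simp add: sum_subtractf power2_eq_square card_cartesian_product flip: sum_divide_distrib)
  qed
  finally show ?thesis by simp
qed

text \<open>For a set of at least n/4 vertices the weighted sum has a factor of at most 1 - (1/4)^2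
  / 2 = 31/32 per edge. Against this stand at most 2^n sets and a factor 2^n from Markov's
  inequality at the threshold n, so the density 100 has to make 4 (31/32)^100 smaller than
  1/2.\<close>

lemma sum_sparse_sets:
  assumes "n > 0"
  shows "(\<Sum>f\<in>multigraphs n (100 * n).
      real (card {S. S \<subseteq> {..<n} \<and> n \<le> 4 * card S \<and> card (spanned (100 * n) f S) < n}))
    < (real n ^ 2) ^ (100 * n) / 2"
proof -
  define m where "m = 100 * n"
  define c :: real where "c = (31 / 32) ^ 100"
  define PS where "PS = {S. S \<subseteq> {..<n} \<and> n \<le> 4 * card S}"
  have PS: "PS \<subseteq> Pow {..<n}" by (auto simp: PS_def)
  then have finPS: "finite PS" and cPS: "card PS \<le> 2 ^ n"
    using finite_subset[of PS] card_mono[of "Pow {..<n}" PS] by (auto simp: card_Pow)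
  have "(\<Sum>f\<in>multigraphs n m.
      real (card {S. S \<subseteq> {..<n} \<and> n \<le> 4 * card S \<and> card (spanned m f S) < n}))
    \<le> (\<Sum>f\<in>multigraphs n m. \<Sum>S\<in>PS. 2 ^ n * (1/2) ^ card (spanned m f S))"
  proof (intro sum_mono)
    fix f
    have "{S. S \<subseteq> {..<n} \<and> n \<le> 4 * card S \<and> card (spanned m f S) < n}
      = PS \<inter> {S. card (spanned m f S) < n}" by (auto simp: PS_def)
    then have "real (card {S. S \<subseteq> {..<n} \<and> n \<le> 4 * card S \<and> card (spanned m f S) < n})
      = (\<Sum>S\<in>PS. of_bool (card (spanned m f S) < n))"
      using finPS by (simp add: sum_of_bool_eq)
    also have "\<dots> \<le> (\<Sum>S\<in>PS. 2 ^ n * (1/2) ^ card (spanned m f S))"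
    proof (rule sum_mono)
      fix S
      have "(1 :: real) \<le> 2 ^ n * (1/2) ^ k" if "k < n" for k
        using that power_increasing[of k n "2 :: real"] by (simp add: field_simps)
      then show "of_bool (card (spanned m f S) < n) \<le> (2 ^ n * (1/2) ^ card (spanned m f S) :: real)"
        by auto
    qed
    finally show "real (card {S. S \<subseteq> {..<n} \<and> n \<le> 4 * card S \<and> card (spanned m f S) < n})
      \<le> (\<Sum>S\<in>PS. 2 ^ n * (1/2) ^ card (spanned m f S))" .
  qed
  also have "\<dots> = (\<Sum>S\<in>PS. 2 ^ n * (\<Sum>f\<in>multigraphs n m. (1/2) ^ card (spanned m f S)))"
    by (subst sum.swap) (simp add: sum_distrib_left)
  also have "\<dots> \<le> (\<Sum>S\<in>PS. 2 ^ n * ((31/32) * real n ^ 2) ^ m)"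
  proof (intro sum_mono mult_left_mono)
    fix S assume "S \<in> PS"
    then have S: "S \<subseteq> {..<n}" "n \<le> 4 * card S" by (auto simp: PS_def)
    have c: "card S \<le> n" using card_mono[OF _ S(1)] by simp
    have "(real n / 4) ^ 2 \<le> real (card S) ^ 2" using S(2) by (intro power_mono) auto
    then have "real n ^ 2 - real (card S) ^ 2 / 2 \<le> (31/32) * real n ^ 2"
      by (simp add: power_divide)
    moreover have "real (card S) ^ 2 \<le> real n ^ 2" using c by (intro power_mono) auto
    then have "0 \<le> real n ^ 2 - real (card S) ^ 2 / 2"
      using zero_le_power2[of "real n"] by linarith
    ultimately show "(\<Sum>f\<in>multigraphs n m. (1/2) ^ card (spanned m f S)) \<le> ((31/32) * real n ^ 2) ^ m"
      unfolding sum_half_power_spanned[OF S(1)] by (intro power_mono) auto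
  qed simp
  also have "\<dots> \<le> 2 ^ n * (2 ^ n * ((31/32) * real n ^ 2) ^ m)"
    using cPS of_nat_mono[OF cPS, where 'a = real]
    by (simp add: mult_right_mono)
  also have "\<dots> = (4 * c) ^ n * (real n ^ 2) ^ m"
  proof -
    have "((31/32) * real n ^ 2) ^ m = c ^ n * (real n ^ 2) ^ m"
      unfolding c_def m_def power_mult_distrib by (simp only: power_mult)
    moreover have "(4 * c) ^ n = 2 ^ n * 2 ^ n * c ^ n"
      unfolding power_mult_distrib[symmetric] by simp
    ultimately show ?thesis by (simp only: mult.assoc)
  qed
  also have "\<dots> < 1 / 2 * (real n ^ 2) ^ m"
  proof (rule mult_strict_right_mono)
    have *: "4 * c < 1 / 2" unfolding c_def power_divide by simp
    have "0 \<le> 4 * c" by (simp add: c_def)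
    then have "(4 * c) ^ n \<le> (4 * c) ^ 1"
      using assms * by (intro power_decreasing) simp_all
    also have "\<dots> < 1 / 2" using * by (simp only: power_one_right)
    finally show "(4 * c) ^ n < 1 / 2" .
  qed (use assms in simp)
  finally show ?thesis by (simp add: m_def)
qed

text \<open>The alteration method. The condition on \<open>S\<close> bounds card S minus the number
  of spanned edges by n/4, which is automatic for sets of at most n/4 vertices; the optima of the
  subdivided graph depend on this difference. The factor 8 makes 4/n times the mean number of short
  closed walks at most 1/2.\<close>

lemma sparse_locally_bipartite_multigraph:
  assumes "8 * 200 ^ Suc l \<le> n"
  shows "\<exists>m f. m \<le> 100 * n \<and> (\<forall>e<m. fst (f e) < n \<and> snd (f e) < n)
    \<and> (\<forall>S\<subseteq>{..<n}. 4 * card S \<le> n + 4 * card (spanned m f S))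
    \<and> (\<forall>x es. set es \<subseteq> {..<m} \<and> walk f x es x \<and> odd (length es) \<longrightarrow> l < length es)"
proof -
  define M where "M = 100 * n"
  have n: "n > 0" using assms by (auto intro!: Nat.gr0I)
  define F where "F = multigraphs n M"
  define bad where "bad f = {S. S \<subseteq> {..<n} \<and> n \<le> 4 * card S \<and> card (spanned M f S) < n}" for f
  define X where "X f = short_cycles M l f" for f
  have finbad: "finite (bad f)" for f
    by (rule finite_subset[of _ "Pow {..<n}"]) (auto simp: bad_def)
  have "\<exists>f\<in>F. bad f = {} \<and> 4 * card (X f) < n"
  proof (rule ccontr)
    assume neg: "\<not> ?thesis"
    \<comment> \<open>Both kinds of failure enter one quantity, which is at least 1 for every
      failing multigraph but has mean below 1.\<close>
    have *: "1 \<le> real (card (bad f)) + 4 * real (card (X f)) / real n" if "f \<in> F" for f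
    proof (cases "bad f = {}")
      case True
      with neg that have "n \<le> 4 * card (X f)" by force
      then have "real n \<le> 4 * real (card (X f))" by linarith
      then show ?thesis using True n by (simp add: field_simps)
    next
      case False
      then have "card (bad f) \<ge> 1" using finbad[of f] by (simp add: Suc_leI card_gt_0_iff)
      then show ?thesis by (simp add: add_increasing2)
    qed
    have "real (card F) = (\<Sum>f\<in>F. 1)" by simp
    also have "\<dots> \<le> (\<Sum>f\<in>F. real (card (bad f)) + 4 * real (card (X f)) / real n)"
      using * by (rule sum_mono)
    also have "\<dots> = (\<Sum>f\<in>F. real (card (bad f))) + 4 / real n * real (\<Sum>f\<in>F. card (X f))"
      by (simp add: sum.distrib sum_distrib_left)
    also have "\<dots> < (real n ^ 2) ^ M / 2 + 4 / real n * (200 ^ Suc l * (real n ^ 2) ^ M)"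
    proof (rule add_less_le_mono)
      show "(\<Sum>f\<in>F. real (card (bad f))) < (real n ^ 2) ^ M / 2"
        unfolding F_def bad_def M_def by (rule sum_sparse_sets[OF n])
      have "real (\<Sum>f\<in>F. card (X f)) \<le> real ((2 * 100) ^ Suc l * (n ^ 2) ^ M)"
        unfolding of_nat_le_iff F_def X_def M_def by (rule sum_short_cycles) (use n in auto)
      then show "4 / real n * real (\<Sum>f\<in>F. card (X f)) \<le> 4 / real n * (200 ^ Suc l * (real n ^ 2) ^ M)"
        by (intro mult_left_mono) auto
    qed
    also have "\<dots> \<le> (real n ^ 2) ^ M / 2 + (real n ^ 2) ^ M / 2"
    proof -
      have "real (8 * 200 ^ Suc l) \<le> real n" using assms by (simp only: of_nat_le_iff)
      then have "4 / real n * 200 ^ Suc l \<le> 1 / 2" using n by (simp add: field_simps)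
      then have "4 / real n * 200 ^ Suc l * (real n ^ 2) ^ M \<le> 1 / 2 * (real n ^ 2) ^ M"
        by (rule mult_right_mono) simp
      then show ?thesis by (simp add: mult.assoc)
    qed
    also have "\<dots> = real (card F)" by (simp add: F_def card_multigraphs)
    finally show False by simp
  qed
  then obtain f where f: "f \<in> F" "bad f = {}" "4 * card (X f) < n" by blast
  \<comment> \<open>Deleting the first edge of every list in \<open>X f\<close> removes fewer than
    n/4 edges, so a set that spanned n edges still spans more than 3 n / 4, and card S \<le> n gives
    the required inequality.\<close>
  define I where "I = {..<M} - hd ` X f"
  define m where "m = card I"
  have finI: "finite I" by (simp add: I_def)
  obtain g where g: "bij_betw g {..<m} I"
    using ex_bij_betw_nat_finite[OF finI] by (auto simp: m_def atLeast0LessThan)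
  have gI: "g e \<in> I" if "e < m" for e using g that by (auto simp: bij_betw_def)
  show ?thesis
  proof (rule exI[of _ m], rule exI[of _ "f \<circ> g"], intro conjI allI impI)
    show "m \<le> 100 * n"
      using card_mono[of "{..<M}" I] by (auto simp: m_def M_def I_def)
  next
    fix e assume e: "e < m"
    have "f (g e) \<in> {..<n} \<times> {..<n}"
    proof -
      have "g e \<in> {..<M}" using gI[OF e] by (auto simp: I_def)
      then show ?thesis
        using f(1) unfolding F_def multigraphs_def by (rule PiE_mem[rotated])
    qed
    then show "fst ((f \<circ> g) e) < n" "snd ((f \<circ> g) e) < n" by auto
  next
    fix S assume S: "S \<subseteq> {..<n}"
    show "4 * card S \<le> n + 4 * card (spanned m (f \<circ> g) S)"
    proof (cases "n \<le> 4 * card S")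
      case True
      have "spanned M f S \<subseteq> g ` spanned m (f \<circ> g) S \<union> hd ` X f"
      proof
        fix e assume e: "e \<in> spanned M f S"
        show "e \<in> g ` spanned m (f \<circ> g) S \<union> hd ` X f"
        proof (cases "e \<in> hd ` X f")
          case False
          then have "e \<in> I" using e by (auto simp: I_def spanned_def)
          then obtain e' where "e' < m" "e = g e'" using g by (auto simp: bij_betw_def)
          then show ?thesis using e by (auto simp: spanned_def)
        qed simp
      qed
      then have "card (spanned M f S) \<le> card (g ` spanned m (f \<circ> g) S \<union> hd ` X f)"
        by (intro card_mono) (auto simp: X_def)
      also have "\<dots> \<le> card (spanned m (f \<circ> g) S) + card (X f)"
        by (intro order.trans[OF card_Un_le] add_mono card_image_le) (auto simp: X_def)
      finally have "card (spanned M f S) \<le> card (spanned m (f \<circ> g) S) + card (X f)" .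
      moreover have "n \<le> card (spanned M f S)" using f(2) S True by (auto simp: bad_def not_less)
      moreover have "card S \<le> n" using card_mono[OF _ S] by simp
      ultimately show ?thesis using f(3) by linarith
    qed simp
  next
    fix x es assume "set es \<subseteq> {..<m} \<and> walk (f \<circ> g) x es x \<and> odd (length es)"
    then have es: "set es \<subseteq> {..<m}" "walk (f \<circ> g) x es x" "odd (length es)" by blast+
    show "l < length es"
    proof (rule ccontr)
      assume "\<not> l < length es"
      have "walk f x (map g es) x" using es(2) by (simp add: walk_map)
      \<comment> \<open>The shortened walk uses surviving edges only and is itself a member of
        \<open>X f\<close>, so its first edge was deleted.\<close>
      from odd_closed_walk_distinct[OF this] es(3) obtain y es' where
        es': "walk f y es' y" "odd (length es')" "distinct es'" "set es' \<subseteq> g ` set es"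
          "length es' \<le> length es" by auto
      have "set es' \<subseteq> I" using es'(4) es(1) gI by blast
      moreover have "es' \<noteq> []" using es'(2) by auto
      ultimately have "hd es' \<in> I" by auto
      moreover have "es' \<in> X f"
        using es' \<open>\<not> l < length es\<close> \<open>es' \<noteq> []\<close> \<open>set es' \<subseteq> I\<close> by (auto simp: X_def short_cycles_def I_def)
      ultimately show False by (auto simp: I_def)
    qed
  qed
qed

section \<open>Subdivided multigraphs\<close>

declare sum_of_bool_eq [simp del]

section \<open>Extremal counts along a single path\<close>

lemma card_eq_sum_of_bool:
  fixes k :: nat
  assumes "X \<subseteq> {..<k}"
  shows "card X = (\<Sum>x<k. of_bool (x \<in> X))"
proof -
  have "{..<k} \<inter> {x. x \<in> X} = X" using assms by auto
  then show ?thesis by (simp add: sum_of_bool_eq)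
qed

lemma sum_no_two_consecutive:
  fixes P :: "nat \<Rightarrow> bool"
  assumes "\<And>i. Suc i < 2 * l \<Longrightarrow> \<not> (P i \<and> P (Suc i))"
  shows "(\<Sum>i<2 * l. of_bool (P i)) \<le> l"
  using assms
proof (induction l)
  case (Suc l)
  have "(\<Sum>i<2 * l. of_bool (P i)) \<le> l" by (rule Suc.IH) (use Suc.prems in auto)
  moreover have "\<not> (P (2 * l) \<and> P (Suc (2 * l)))" by (rule Suc.prems) simp
  ultimately show ?case by auto
qed simp

text \<open>The ends are positions 0 and 2 l + 1. If both are chosen, their neighbours are not, and
  2 (l - 1) inner positions remain, hence one fewer. For l = 0 the ends are adjacent and cannot both
  be chosen.\<close>

lemma sum_independent_path:
  fixes P :: "nat \<Rightarrow> bool"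
  assumes "\<And>i. i \<le> 2 * l \<Longrightarrow> \<not> (P i \<and> P (Suc i))"
  shows "(\<Sum>i<2 * l. of_bool (P (Suc i))) + of_bool (P 0 \<and> P (Suc (2 * l))) \<le> l"
proof (cases "l > 0 \<and> P 0 \<and> P (Suc (2 * l))")
  case True
  then obtain l' where l': "l = Suc l'" by (cases l) auto
  have "\<not> P (Suc 0)" "\<not> P (2 * l)" using assms[of 0] assms[of "2 * l"] True by auto
  have "(\<Sum>i<2 * l. of_bool (P (Suc i))) = (\<Sum>i<Suc (Suc (2 * l')). of_bool (P (Suc i)) :: nat)"
    by (simp add: l')
  also have "\<dots> = (\<Sum>i<Suc (2 * l'). of_bool (P (Suc (Suc i))))"
    using \<open>\<not> P (Suc 0)\<close> by (subst sum.lessThan_Suc_shift) simp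
  also have "\<dots> = (\<Sum>i<2 * l'. of_bool (P (Suc (Suc i))))"
    using \<open>\<not> P (2 * l)\<close> by (simp add: l')
  also have "\<dots> \<le> l'" by (rule sum_no_two_consecutive) (use assms l' in auto)
  finally show ?thesis using True l' by simp
next
  case False
  have "(\<Sum>i<2 * l. of_bool (P (Suc i))) \<le> l" by (rule sum_no_two_consecutive) (use assms in auto)
  then show ?thesis using False assms[of 0] by (cases "l = 0") auto
qed

lemma sum_hitting_triples:
  fixes P :: "nat \<Rightarrow> bool"
  assumes "\<And>i. i < k \<Longrightarrow> P (3 * i) \<or> P (Suc (3 * i)) \<or> P (Suc (Suc (3 * i)))"
  shows "k \<le> (\<Sum>i<3 * k. of_bool (P i))"
  using assms
proof (induction k)
  case (Suc k)
  have "k \<le> (\<Sum>i<3 * k. of_bool (P i))" by (rule Suc.IH) (use Suc.prems in auto)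
  moreover have "P (3 * k) \<or> P (Suc (3 * k)) \<or> P (Suc (Suc (3 * k)))" by (rule Suc.prems) simp
  moreover have "3 * Suc k = Suc (Suc (Suc (3 * k)))" by simp
  ultimately show ?case unfolding \<open>3 * Suc k = _\<close> sum.lessThan_Suc by auto
qed simp

text \<open>With both ends unchosen, the 3 k + 3 positions split into k + 1 triples, each centred at
  an inner position and containing a chosen one, which must be inner. Otherwise the k disjoint
  triples among the inner positions are used.\<close>

lemma sum_dominating_path:
  fixes P :: "nat \<Rightarrow> bool"
  assumes "\<And>i. i < 3 * k + 1 \<Longrightarrow> P i \<or> P (Suc i) \<or> P (Suc (Suc i))"
  shows "k + of_bool (\<not> P 0 \<and> \<not> P (Suc (3 * k + 1))) \<le> (\<Sum>i<3 * k + 1. of_bool (P (Suc i)))"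
proof (cases "\<not> P 0 \<and> \<not> P (Suc (3 * k + 1))")
  case True
  have "Suc k \<le> (\<Sum>i<3 * Suc k. of_bool (P i))"
    by (rule sum_hitting_triples) (use assms in auto)
  also have "\<dots> = (\<Sum>i<3 * k + 1. of_bool (P (Suc i)))"
  proof -
    have "3 * Suc k = Suc (Suc (3 * k + 1))" by simp
    then have "(\<Sum>i<3 * Suc k. of_bool (P i)) = (\<Sum>i<Suc (3 * k + 1). of_bool (P i) :: nat)"
      using True unfolding \<open>3 * Suc k = _\<close> by (subst sum.lessThan_Suc) simp
    also have "\<dots> = (\<Sum>i<3 * k + 1. of_bool (P (Suc i)))"
      using True by (subst sum.lessThan_Suc_shift) simp
    finally show ?thesis .
  qed
  finally show ?thesis using True by simp
next
  case False
  have "k \<le> (\<Sum>i<3 * k. of_bool (P (Suc i)))"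
    by (rule sum_hitting_triples) (use assms in auto)
  then show ?thesis using False by auto
qed

text \<open>An alternating colouring along the q + 1 edges would give the ends different colours, as
  q + 1 is odd.\<close>

lemma odd_path_monochromatic_edge:
  fixes c :: "nat \<Rightarrow> bool"
  assumes "even q" "c 0 = c (Suc q)"
  shows "\<exists>i\<le>q. c i = c (Suc i)"
proof (rule ccontr)
  assume neg: "\<not> ?thesis"
  have "c i = (c 0 = even i)" if "i \<le> Suc q" for i
    using that by (induction i) (use neg in auto)
  from this[of "Suc q"] assms show False by simp
qed

text \<open>The residues {0, 5} and {2, 3} will be the two halves of a dominating set of the double
  cover. A period of six contains four of them, and the last four positions, with residues 1 to 4,
  contain two.\<close>

lemma sum_of_bool_mod_6:
  "(\<Sum>i<6 * j + 4. of_bool (Suc i mod 6 \<in> {0, 5}) + of_bool (Suc i mod 6 \<in> {2, 3})) = 2 * (2 * j + 1 :: nat)"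
proof (induction j)
  case 0
  have "6 * 0 + 4 = Suc (Suc (Suc (Suc 0)))" by simp
  then show ?case by (simp only: sum.lessThan_Suc) simp
next
  case (Suc j)
  have s: "6 * Suc j + 4 = Suc (Suc (Suc (Suc (Suc (Suc (6 * j + 4))))))" by simp
  have mods: "Suc (6 * j + 4) mod 6 = 5" "Suc (Suc (6 * j + 4)) mod 6 = 0"
    "Suc (Suc (Suc (6 * j + 4))) mod 6 = 1" "Suc (Suc (Suc (Suc (6 * j + 4)))) mod 6 = 2"
    "Suc (Suc (Suc (Suc (Suc (6 * j + 4))))) mod 6 = 3"
    "Suc (Suc (Suc (Suc (Suc (Suc (6 * j + 4)))))) mod 6 = 4"
    by presburger+
  show ?case unfolding s sum.lessThan_Suc mods using Suc by simp
qed

section \<open>The subdivided graph\<close>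

locale subdivision =
  fixes n m j :: nat and f :: "nat \<Rightarrow> nat \<times> nat"
  assumes ends: "e < m \<Longrightarrow> fst (f e) < n \<and> snd (f e) < n"
    and spans: "S \<subseteq> {..<n} \<Longrightarrow> 4 * card S \<le> n + 4 * card (spanned m f S)"
begin

text \<open>Every edge of the multigraph becomes a path with \<open>q\<close> internal vertices, and every vertex \<open>v\<close>
  gets a pendant path \<open>v\<close>, \<open>n + v\<close>, \<open>2 * n + v\<close>, which takes care of the domination of \<open>v\<close>. As \<open>q\<close>
  is even, the optima for independent sets and cuts see which edges have both ends in the solution
  resp. on the same side; as \<open>q\<close> is \<open>1\<close> modulo \<open>3\<close>, dominating a path costs one more vertex if
  neither of its ends is chosen.\<close>

definition q :: nat where "q = 6 * j + 4"

definition base_size :: nat where "base_size = 3 * n + m * q"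

definition internal :: "nat \<Rightarrow> nat \<Rightarrow> nat" where "internal e i = 3 * n + (e * q + i)"

text \<open>Positions 0 and q + 1 are the ends of the multigraph edge, so a single index runs
  through the whole path and the edge set needs no separate clauses for the ends.\<close>

definition pos :: "nat \<Rightarrow> nat \<Rightarrow> nat" where
  "pos e i = (if i = 0 then fst (f e) else if i = Suc q then snd (f e) else internal e (i - 1))"

definition edges :: "nat set set" where
  "edges = {{pos e i, pos e (Suc i)} | e i. e < m \<and> i \<le> q}
    \<union> {{v, n + v} | v. v < n} \<union> {{n + v, 2 * n + v} | v. v < n}"

text \<open>Numbers below n, 2 n and 3 n are original vertices, middles and leaves of the pendant
  paths; then come q numbers per edge. All vertex functions constructed below (dominating pattern,
  distance bound, 2-colouring) are given piecewise along this numbering.\<close>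

definition glue :: "(nat \<Rightarrow> 'b) \<Rightarrow> (nat \<Rightarrow> 'b) \<Rightarrow> (nat \<Rightarrow> 'b) \<Rightarrow> (nat \<Rightarrow> nat \<Rightarrow> 'b) \<Rightarrow> nat \<Rightarrow> 'b" where
  "glue g\<^sub>0 g\<^sub>1 g\<^sub>2 h x = (if x < n then g\<^sub>0 x else if x < 2 * n then g\<^sub>1 (x - n)
    else if x < 3 * n then g\<^sub>2 (x - 2 * n) else h ((x - 3 * n) div q) ((x - 3 * n) mod q))"

lemma q_pos: "q > 0" by (simp add: q_def)

lemma glue_simps [simp]:
  "v < n \<Longrightarrow> glue g\<^sub>0 g\<^sub>1 g\<^sub>2 h v = g\<^sub>0 v"
  "v < n \<Longrightarrow> glue g\<^sub>0 g\<^sub>1 g\<^sub>2 h (n + v) = g\<^sub>1 v"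
  "v < n \<Longrightarrow> glue g\<^sub>0 g\<^sub>1 g\<^sub>2 h (2 * n + v) = g\<^sub>2 v"
  "i < q \<Longrightarrow> glue g\<^sub>0 g\<^sub>1 g\<^sub>2 h (internal e i) = h e i"
  by (auto simp: glue_def internal_def)

lemma glue_pos:
  assumes "e < m" "i \<le> Suc q"
  shows "glue g\<^sub>0 g\<^sub>1 g\<^sub>2 h (pos e i) = (if i = 0 then g\<^sub>0 (fst (f e)) else if i = Suc q then g\<^sub>0 (snd (f e))
    else h e (i - 1))"
  using assms ends[of e] q_pos by (auto simp: pos_def)

lemma internal_less: "e < m \<Longrightarrow> i < q \<Longrightarrow> internal e i < base_size"
proof -
  assume "e < m" "i < q"
  then have "e * q + i < Suc e * q" by simp
  also have "\<dots> \<le> m * q" using \<open>e < m\<close> by (intro mult_right_mono) auto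
  finally show ?thesis by (simp add: internal_def base_size_def)
qed

lemma pos_less: "e < m \<Longrightarrow> i \<le> Suc q \<Longrightarrow> pos e i < base_size"
  using ends[of e] internal_less[of e "i - 1"] by (auto simp: pos_def base_size_def)

lemma internal_inject: "i < q \<Longrightarrow> i' < q \<Longrightarrow> internal e i = internal e' i' \<longleftrightarrow> e = e' \<and> i = i'"
proof
  assume i: "i < q" "i' < q" and eq: "internal e i = internal e' i'"
  from eq have "(e * q + i) div q = (e' * q + i') div q" "(e * q + i) mod q = (e' * q + i') mod q"
    by (simp_all add: internal_def)
  then show "e = e' \<and> i = i'" using i by simp
qed simp

lemma pos_internal: "0 < i \<Longrightarrow> i \<le> q \<Longrightarrow> pos e i = internal e (i - 1)"
  by (simp add: pos_def)

lemma pos_end: "e < m \<Longrightarrow> i = 0 \<or> i = Suc q \<Longrightarrow> pos e i < n"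
  using ends[of e] by (auto simp: pos_def)

lemma internal_ge: "3 * n \<le> internal e i" by (simp add: internal_def)

text \<open>Every step of a path has an internal end, so even a loop of the multigraph is turned
  into edges of a simple graph.\<close>

lemma pos_neq_Suc: 
  assumes "e < m" "i \<le> q"
  shows "pos e i \<noteq> pos e (Suc i)"
proof -
  consider "i = 0" | "i = q" | "0 < i" "i < q" using assms(2) by linarith
  then show ?thesis
  proof cases
    case 1
    then show ?thesis using assms ends[of e] internal_ge[of e 0] q_pos by (auto simp: pos_def)
  next
    case 2
    then show ?thesis using assms ends[of e] internal_ge[of e "q - 1"] q_pos by (auto simp: pos_def)
  next
    case 3
    then show ?thesis using internal_inject[of "i - 1" i e e] by (auto simp: pos_def)
  qed
qed

lemma vertex_cases:
  assumes "x < base_size"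
  obtains (orig) v where "v < n" "x = v" | (mid) v where "v < n" "x = n + v"
    | (leaf) v where "v < n" "x = 2 * n + v" | (internal) e i where "e < m" "i < q" "x = internal e i"
proof -
  consider "x < n" | "n \<le> x" "x < 2 * n" | "2 * n \<le> x" "x < 3 * n" | "3 * n \<le> x" by linarith
  then show thesis
  proof cases
    case 1
    then show ?thesis using orig by blast
  next
    case 2
    then show ?thesis using mid[of "x - n"] by auto
  next
    case 3
    then show ?thesis using leaf[of "x - 2 * n"] by auto
  next
    case 4
    then have "x - 3 * n < m * q" using assms by (auto simp: base_size_def)
    then show ?thesis using 4 q_pos
      by (intro internal[of "(x - 3 * n) div q" "(x - 3 * n) mod q"])
        (auto simp: internal_def less_mult_imp_div_less)
  qed
qed

lemma edge_cases:
  assumes "{u, u'} \<in> edges"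
  obtains (path) e i where "e < m" "i \<le> q" "u = pos e i" "u' = pos e (Suc i)"
    | (path') e i where "e < m" "i \<le> q" "u' = pos e i" "u = pos e (Suc i)"
    | (mid) v where "v < n" "u = v" "u' = n + v"
    | (mid') v where "v < n" "u' = v" "u = n + v"
    | (leaf) v where "v < n" "u = n + v" "u' = 2 * n + v"
    | (leaf') v where "v < n" "u' = n + v" "u = 2 * n + v"
  using assms by (auto simp: edges_def doubleton_eq_iff)

lemma simple_edges: "simple_graph base_size edges"
  unfolding simple_graph_def
proof
  fix e assume "e \<in> edges"
  then consider e' i where "e' < m" "i \<le> q" "e = {pos e' i, pos e' (Suc i)}"
    | v where "v < n" "e = {v, n + v}" | v where "v < n" "e = {n + v, 2 * n + v}"
    by (auto simp: edges_def)
  then show "e \<subseteq> {..<base_size} \<and> card e = 2"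
  proof cases
    case 1
    then show ?thesis using pos_less[of e' i] pos_less[of e' "Suc i"] pos_neq_Suc[of e' i] by auto
  qed (auto simp: base_size_def)
qed

lemma path_edge: "e < m \<Longrightarrow> i \<le> q \<Longrightarrow> {pos e i, pos e (Suc i)} \<in> edges"
  by (auto simp: edges_def)

lemma mid_edge: "v < n \<Longrightarrow> {v, n + v} \<in> edges" and leaf_edge: "v < n \<Longrightarrow> {n + v, 2 * n + v} \<in> edges"
  by (auto simp: edges_def)

lemma neighbour_of_internal:
  assumes "{u, internal e i} \<in> edges" "i < q"
  shows "u = pos e i \<or> u = pos e (Suc (Suc i))"
proof -
  have *: "i' = Suc i \<and> e' = e" if "e' < m" "i' \<le> Suc q" "internal e i = pos e' i'" for e' i'
  proof -
    have "\<not> (i' = 0 \<or> i' = Suc q)"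
    proof
      assume "i' = 0 \<or> i' = Suc q"
      from pos_end[OF that(1) this] that(3) internal_ge[of e i] show False by simp
    qed
    then show ?thesis using that assms(2) internal_inject[of i "i' - 1" e e'] by (auto simp: pos_def)
  qed
  from assms(1) show ?thesis
  proof (cases rule: edge_cases)
    case (path e' i')
    then show ?thesis using *[of e' "Suc i'"] by auto
  next
    case (path' e' i')
    then show ?thesis using *[of e' i'] by auto
  qed (use internal_ge[of e i] in auto)
qed

lemma neighbour_of_leaf:
  assumes "{u, 2 * n + v} \<in> edges" "v < n"
  shows "u = n + v"
proof -
  have *: "pos e i \<noteq> 2 * n + v" if "e < m" "i \<le> Suc q" for e i
    using that pos_end[of e i] internal_ge[of e "i - 1"] assms(2)
    by (cases "i = 0 \<or> i = Suc q") (auto simp: pos_def)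
  from assms(1) show ?thesis
    by (cases rule: edge_cases) (use assms(2) * in \<open>auto dest: sym\<close>)
qed

lemma sum_vertices:
  "(\<Sum>x<base_size. g x :: nat) = (\<Sum>v<n. g v + g (n + v) + g (2 * n + v)) + (\<Sum>e<m. \<Sum>i<q. g (internal e i))"
proof -
  have shift: "(\<Sum>x<a + b. g x :: nat) = (\<Sum>x<a. g x) + (\<Sum>x<b. g (a + x))" for a b and g :: "nat \<Rightarrow> nat"
    by (induction b) auto
  have "(\<Sum>x<base_size. g x) = (\<Sum>v<n. g v) + (\<Sum>v<n. g (n + v)) + (\<Sum>v<n. g (2 * n + v))
      + (\<Sum>x<m * q. g (3 * n + x))"
  proof -
    have "base_size = n + (n + (n + m * q))" by (simp add: base_size_def)
    moreover have "2 * n = n + n" "3 * n = n + (n + n)" by simp_all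
    ultimately show ?thesis by (simp only: shift add.assoc)
  qed
  also have "(\<Sum>x<m * q. g (3 * n + x)) = (\<Sum>e<m. \<Sum>i<q. g (internal e i))"
  proof -
    have "(\<Sum>x<k * q. g (3 * n + x)) = (\<Sum>e<k. \<Sum>i<q. g (internal e i))" for k
    proof (induction k)
      case (Suc k)
      have "Suc k * q = k * q + q" by simp
      then show ?case using Suc by (simp only: shift sum.lessThan_Suc) (simp add: internal_def)
    qed simp
    then show ?thesis .
  qed
  finally show ?thesis by (simp add: sum.distrib)
qed

lemma card_vertices:
  assumes "X \<subseteq> {..<base_size}"
  shows "card X = (\<Sum>v<n. of_bool (v \<in> X) + of_bool (n + v \<in> X) + of_bool (2 * n + v \<in> X))
    + (\<Sum>e<m. \<Sum>i<q. of_bool (pos e (Suc i) \<in> X))"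
proof -
  have "(\<Sum>i<q. of_bool (internal e i \<in> X)) = (\<Sum>i<q. of_bool (pos e (Suc i) \<in> X) :: nat)" for e
    by (intro sum.cong) (auto simp: pos_internal)
  then show ?thesis unfolding card_eq_sum_of_bool[OF assms] sum_vertices by simp
qed

lemma card_spanned: "card (spanned m f S) = (\<Sum>e<m. of_bool (fst (f e) \<in> S \<and> snd (f e) \<in> S))"
proof -
  have "{..<m} \<inter> {e. fst (f e) \<in> S \<and> snd (f e) \<in> S} = spanned m f S" by (auto simp: spanned_def)
  then show ?thesis by (simp add: sum_of_bool_eq)
qed

section \<open>Optima of the subdivided graph\<close>

text \<open>Each pair of middle and leaf contributes at most one vertex, and a path at most q/2, one
  less if both of its ends lie in \<open>S\<close>. So card I is at most n + m q / 2 plus card S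
  minus the number of edges spanned by \<open>S\<close>, and the last difference is at most n/4.
  Half of all vertices would be 3 n / 2 + m q / 2; the deficit is n/4.\<close>

lemma independent_set_bound:
  assumes "independent_set base_size edges I"
  shows "2 * card I + n \<le> base_size + n div 2"
proof -
  have sub: "I \<subseteq> {..<base_size}" and ind: "\<And>e. e \<in> edges \<Longrightarrow> \<not> e \<subseteq> I"
    using assms by (auto simp: independent_set_def)
  define S where "S = I \<inter> {..<n}"
  have V: "(\<Sum>v<n. of_bool (v \<in> I) + of_bool (n + v \<in> I) + of_bool (2 * n + v \<in> I)) \<le> card S + n"
  proof -
    have "(\<Sum>v<n. of_bool (v \<in> I) + of_bool (n + v \<in> I) + of_bool (2 * n + v \<in> I))
      \<le> (\<Sum>v<n. of_bool (v \<in> S) + 1 :: nat)"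
    proof (rule sum_mono)
      fix v assume v: "v \<in> {..<n}"
      have "\<not> {n + v, 2 * n + v} \<subseteq> I" using v by (intro ind leaf_edge) auto
      then show "of_bool (v \<in> I) + of_bool (n + v \<in> I) + of_bool (2 * n + v \<in> I)
        \<le> (of_bool (v \<in> S) + 1 :: nat)" using v by (auto simp: S_def)
    qed
    also have "\<dots> = card S + n"
      by (subst card_eq_sum_of_bool[of S n]) (auto simp: S_def sum_Suc)
    finally show ?thesis .
  qed
  have P: "(\<Sum>e<m. \<Sum>i<q. of_bool (pos e (Suc i) \<in> I)) + card (spanned m f S) \<le> m * (3 * j + 2)"
  proof -
    have "(\<Sum>i<q. of_bool (pos e (Suc i) \<in> I)) + of_bool (fst (f e) \<in> S \<and> snd (f e) \<in> S) \<le> 3 * j + 2"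
      if e: "e < m" for e
    proof -
      have "q = 2 * (3 * j + 2)" by (simp add: q_def)
      moreover have "\<not> (pos e i \<in> I \<and> pos e (Suc i) \<in> I)" if "i \<le> q" for i
        using ind[OF path_edge[OF e that]] by auto
      ultimately have "(\<Sum>i<q. of_bool (pos e (Suc i) \<in> I)) + of_bool (pos e 0 \<in> I \<and> pos e (Suc q) \<in> I)
          \<le> 3 * j + 2"
        using sum_independent_path[of "3 * j + 2" "\<lambda>i. pos e i \<in> I"] by simp
      moreover have "pos e 0 = fst (f e)" "pos e (Suc q) = snd (f e)" by (auto simp: pos_def)
      ultimately show ?thesis using ends[OF e] by (simp add: S_def)
    qed
    then have "(\<Sum>e<m. (\<Sum>i<q. of_bool (pos e (Suc i) \<in> I)) + of_bool (fst (f e) \<in> S \<and> snd (f e) \<in> S))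
      \<le> (\<Sum>e<m. 3 * j + 2)" by (intro sum_mono) auto
    then show ?thesis by (simp add: card_spanned sum.distrib)
  qed
  have "4 * card S \<le> n + 4 * card (spanned m f S)" by (rule spans) (auto simp: S_def)
  moreover have "card I + card (spanned m f S) \<le> card S + n + m * (3 * j + 2)"
    using V P unfolding card_vertices[OF sub] by linarith
  moreover have "base_size = 3 * n + 2 * (m * (3 * j + 2))" by (simp add: base_size_def q_def algebra_simps)
  ultimately show ?thesis by linarith
qed

text \<open>A multigraph edge with both ends on one side yields an uncut edge on its path. Applied
  to both sides, \<open>spans\<close> gives at least n/2 such edges, because the two sides together
  contain all n original vertices.\<close>

lemma cut_bound:
  assumes "is_cut base_size edges F"
  shows "2 * card F + n \<le> 2 * card edges"
proof -
  obtain S T where ST: "S \<union> T = {..<base_size}" "S \<inter> T = {}" "F = {e \<in> edges. e \<inter> S \<noteq> {} \<and> e \<inter> T \<noteq> {}}"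
    using assms by (auto simp: is_cut_def)
  have finE: "finite edges"
    using simple_edges by (intro finite_subset[of edges "Pow {..<base_size}"]) (auto simp: simple_graph_def)
  define S' where "S' = S \<inter> {..<n}"
  define T' where "T' = T \<inter> {..<n}"
  define M where "M = spanned m f S' \<union> spanned m f T'"
  have n_size: "n \<le> base_size" by (simp add: base_size_def)
  have "\<exists>i\<le>q. (pos e i \<in> S) = (pos e (Suc i) \<in> S)" if e: "e \<in> M" for e
  proof (rule odd_path_monochromatic_edge)
    show "even q" by (simp add: q_def)
    show "(pos e 0 \<in> S) = (pos e (Suc q) \<in> S)"
      using e ST(2) by (auto simp: M_def spanned_def pos_def S'_def T'_def)
  qed
  then obtain k where k: "\<And>e. e \<in> M \<Longrightarrow> k e \<le> q \<and> (pos e (k e) \<in> S) = (pos e (Suc (k e)) \<in> S)"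
    by metis
  have Mm: "e < m" if "e \<in> M" for e using that by (auto simp: M_def spanned_def)
  define g where "g e = {pos e (k e), pos e (Suc (k e))}" for e
  have "g ` M \<subseteq> edges - F"
  proof
    fix x assume "x \<in> g ` M"
    then obtain e where e: "e \<in> M" "x = g e" by auto
    have "x \<in> edges" using path_edge[OF Mm[OF e(1)]] k[OF e(1)] by (simp add: e(2) g_def)
    moreover have "x \<notin> F" using k[OF e(1)] ST(2) by (auto simp: ST(3) e(2) g_def)
    ultimately show "x \<in> edges - F" by blast
  qed
  \<comment> \<open>Each edge of a path contains an internal vertex, which determines the path;
    hence different paths lose different edges.\<close>
  moreover have "inj_on g M"
  proof (rule inj_onI)
    fix e e' assume e: "e \<in> M" "e' \<in> M" "g e = g e'"
    have *: "\<exists>i<q. internal e i \<in> g e" if "e \<in> M" for e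
    proof (cases "k e = 0")
      case True
      then show ?thesis using q_pos by (intro exI[of _ 0]) (auto simp: g_def pos_def)
    next
      case False
      then show ?thesis using k[OF that] by (intro exI[of _ "k e - 1"]) (auto simp: g_def pos_def)
    qed
    from *[OF e(1)] e(3) obtain i where i: "i < q" "internal e i \<in> g e'" by auto
    have "internal e i = pos e' (k e') \<or> internal e i = pos e' (Suc (k e'))"
      using i(2) by (simp add: g_def)
    then obtain i' where i': "i' \<le> Suc q" "internal e i = pos e' i'"
      using k[OF e(2)] by (metis Suc_le_mono le_Suc_eq)
    have "\<not> (i' = 0 \<or> i' = Suc q)"
    proof
      assume "i' = 0 \<or> i' = Suc q"
      from pos_end[OF Mm[OF e(2)] this] i'(2) internal_ge[of e i] show False by simp
    qed
    then show "e = e'" using i' i(1) internal_inject[of i "i' - 1" e e'] by (auto simp: pos_def)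
  qed
  ultimately have "card M \<le> card (edges - F)"
    using finE by (metis card_image card_mono finite_Diff)
  also have "card (edges - F) = card edges - card F"
    using finE ST(3) by (intro card_Diff_subset) auto
  finally have 1: "card M \<le> card edges - card F" .
  have "card F \<le> card edges" using finE ST(3) by (intro card_mono) auto
  moreover have "card M = card (spanned m f S') + card (spanned m f T')"
    unfolding M_def using ST(2) by (intro card_Un_disjoint) (auto simp: spanned_def S'_def T'_def)
  moreover have "card S' + card T' = n"
  proof -
    have "card (S' \<union> T') = card S' + card T'"
      using ST(2) by (intro card_Un_disjoint) (auto simp: S'_def T'_def)
    moreover have "S' \<union> T' = (S \<union> T) \<inter> {..<n}" by (auto simp: S'_def T'_def)
    moreover have "(S \<union> T) \<inter> {..<n} = {..<n}" unfolding ST(1) using n_size by auto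
    ultimately show ?thesis by simp
  qed
  moreover have "4 * card S' \<le> n + 4 * card (spanned m f S')" "4 * card T' \<le> n + 4 * card (spanned m f T')"
    by (auto intro!: spans simp: S'_def T'_def)
  ultimately show ?thesis using 1 by linarith
qed

text \<open>Here \<open>S\<close> consists of the original vertices outside \<open>D\<close>. The
  leaves force n middles or leaves, n - card S original vertices are chosen, and a path costs one
  vertex more if both of its ends lie in \<open>S\<close>. Since card S exceeds the number of
  spanned edges by at most n/4, the total is at least 7 n / 4 + m (2 j + 1).\<close>

lemma dominating_set_bound:
  assumes "dominating_set base_size edges D"
  shows "7 * n + 4 * (m * (2 * j + 1)) \<le> 4 * card D"
proof -
  have sub: "D \<subseteq> {..<base_size}" and dom: "\<And>v. v < base_size \<Longrightarrow> v \<in> D \<or> (\<exists>u\<in>D. {u, v} \<in> edges)"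
    using assms by (auto simp: dominating_set_def)
  define S where "S = {..<n} - D"
  have V: "n + (n - card S) \<le> (\<Sum>v<n. of_bool (v \<in> D) + of_bool (n + v \<in> D) + of_bool (2 * n + v \<in> D))"
  proof -
    have "n - card S = card ({..<n} \<inter> D)"
      unfolding S_def using card_mono[of "{..<n}" "{..<n} \<inter> D"] by (subst card_Diff_subset_Int) auto
    then have "n + (n - card S) = (\<Sum>v<n. 1 + of_bool (v \<in> {..<n} \<inter> D))"
      by (subst sum.distrib) (simp add: card_eq_sum_of_bool[of "{..<n} \<inter> D" n])
    also have "\<dots> \<le> (\<Sum>v<n. of_bool (v \<in> D) + of_bool (n + v \<in> D) + of_bool (2 * n + v \<in> D))"
    proof (rule sum_mono)
      fix v assume v: "v \<in> {..<n}"
      then have "2 * n + v < base_size" by (auto simp: base_size_def)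
      then have "2 * n + v \<in> D \<or> n + v \<in> D" using dom[of "2 * n + v"] neighbour_of_leaf v by blast
      then show "1 + of_bool (v \<in> {..<n} \<inter> D)
        \<le> (of_bool (v \<in> D) + of_bool (n + v \<in> D) + of_bool (2 * n + v \<in> D) :: nat)"
        using v by auto
    qed
    finally show ?thesis .
  qed
  have P: "m * (2 * j + 1) + card (spanned m f S) \<le> (\<Sum>e<m. \<Sum>i<q. of_bool (pos e (Suc i) \<in> D))"
  proof -
    have "2 * j + 1 + of_bool (fst (f e) \<in> S \<and> snd (f e) \<in> S) \<le> (\<Sum>i<q. of_bool (pos e (Suc i) \<in> D))"
      if e: "e < m" for e
    proof -
      have q: "q = 3 * (2 * j + 1) + 1" by (simp add: q_def)
      have "pos e i \<in> D \<or> pos e (Suc i) \<in> D \<or> pos e (Suc (Suc i)) \<in> D" if i: "i < q" for i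
      proof -
        have "pos e (Suc i) = internal e i" using i by (simp add: pos_internal)
        then show ?thesis
          using dom[OF internal_less[OF e i]] neighbour_of_internal[of _ e i] i by auto
      qed
      then have "2 * j + 1 + of_bool (pos e 0 \<notin> D \<and> pos e (Suc q) \<notin> D)
          \<le> (\<Sum>i<q. of_bool (pos e (Suc i) \<in> D))"
        using sum_dominating_path[of "2 * j + 1" "\<lambda>i. pos e i \<in> D"] unfolding q by blast
      moreover have "pos e 0 = fst (f e)" "pos e (Suc q) = snd (f e)" by (auto simp: pos_def)
      ultimately show ?thesis using ends[OF e] by (simp add: S_def)
    qed
    then have "(\<Sum>e<m. 2 * j + 1 + of_bool (fst (f e) \<in> S \<and> snd (f e) \<in> S))
      \<le> (\<Sum>e<m. \<Sum>i<q. of_bool (pos e (Suc i) \<in> D))" by (intro sum_mono) auto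
    then show ?thesis by (simp add: card_spanned sum.distrib sum_Suc algebra_simps)
  qed
  have "4 * card S \<le> n + 4 * card (spanned m f S)" by (rule spans) (auto simp: S_def)
  moreover have "card S \<le> n" using card_mono[of "{..<n}" S] by (auto simp: S_def)
  moreover have "7 * n + 4 * k \<le> 4 * (a + b)"
    if "4 * s \<le> n + 4 * e" "s \<le> n" "n + (n - s) \<le> a" "k + e \<le> b" for a b e k s :: nat
  proof -
    have "8 * n \<le> 4 * a + 4 * s" using that(2,3) by linarith
    moreover have "4 * k + 4 * e \<le> 4 * b" using that(4) by linarith
    ultimately show ?thesis using that(1) unfolding add_mult_distrib2 by linarith
  qed
  ultimately show ?thesis using V P unfolding card_vertices[OF sub] by blast
qed

lemma dominating_pair:
  "\<exists>D\<^sub>0 D\<^sub>1. D\<^sub>0 \<subseteq> {..<base_size} \<and> D\<^sub>1 \<subseteq> {..<base_size}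
    \<and> (\<forall>v<base_size. v \<in> D\<^sub>0 \<or> (\<exists>u\<in>D\<^sub>1. {u, v} \<in> edges))
    \<and> (\<forall>v<base_size. v \<in> D\<^sub>1 \<or> (\<exists>u\<in>D\<^sub>0. {u, v} \<in> edges))
    \<and> card D\<^sub>0 + card D\<^sub>1 = 3 * n + 2 * (m * (2 * j + 1))"
proof -
  \<comment> \<open>In the flip lift, \<open>D True\<close> lives on the layer where all original vertices are chosen. A path
    starts on one layer and ends on the other, whence the two residues modulo \<open>3\<close>, split by parity.\<close>
  define D where "D b = {x. x < base_size \<and> glue (\<lambda>_. b) (\<lambda>_. True) (\<lambda>_. False)
    (\<lambda>e i. Suc i mod 6 \<in> (if b then {0, 5} else {2, 3})) x}" for b
  have sub: "D b \<subseteq> {..<base_size}" for b by (auto simp: D_def)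
  have pos_D: "pos e i \<in> D b \<longleftrightarrow> i mod 6 \<in> (if b then {0, 5} else {2, 3})" if "e < m" "i \<le> Suc q" for e i b
  proof -
    \<comment> \<open>Positions 0 and q + 1 have residues 0 and 5, which belong to the pattern of
      \<open>D True\<close> and not to that of \<open>D False\<close>, exactly like the original
      vertices there; so one residue rule covers the ends too.\<close>
    have "Suc q mod 6 = 5" unfolding q_def by presburger
    then show ?thesis using that pos_less[OF that] by (auto simp: D_def glue_pos)
  qed
  have V_D: "v \<in> D b \<longleftrightarrow> b" "n + v \<in> D b" "2 * n + v \<notin> D b" if "v < n" for v b
    using that by (auto simp: D_def base_size_def)
  have dom: "v \<in> D b \<or> (\<exists>u\<in>D (\<not> b). {u, v} \<in> edges)" if "v < base_size" for v b
    using that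
  proof (cases rule: vertex_cases)
    case (orig v')
    then show ?thesis using V_D mid_edge[of v'] by (auto simp: insert_commute)
  next
    case (mid v')
    then show ?thesis using V_D by auto
  next
    case (leaf v')
    then show ?thesis using V_D leaf_edge[of v'] by auto
  next
    case (internal e i)
    have v: "v = pos e (Suc i)" using internal by (simp add: pos_internal)
    have *: "?thesis" if "i' \<le> Suc q" "i = i' \<or> i' = Suc (Suc i)" "i' mod 6 \<in> (if \<not> b then {0, 5} else {2, 3})" for i'
    proof -
      have "pos e i' \<in> D (\<not> b)" using that internal(1) by (subst pos_D) auto
      moreover have "{pos e i', v} \<in> edges"
        using that(2) internal(1,2) path_edge[of e i] path_edge[of e "Suc i"] by (auto simp: v insert_commute)
      ultimately show ?thesis by blast
    qed
    consider "Suc i mod 6 \<in> (if b then {0, 5} else {2, 3})" | "i mod 6 \<in> (if \<not> b then {0, 5} else {2, 3})"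
      | "Suc (Suc i) mod 6 \<in> (if \<not> b then {0, 5} else {2, 3})"
    proof -
      have "i mod 6 \<in> {0, 1, 2, 3, 4, 5}" by (simp, presburger)
      then have "Suc i mod 6 \<in> (if b then {0, 5} else {2, 3}) \<or> i mod 6 \<in> (if \<not> b then {0, 5} else {2, 3})
          \<or> Suc (Suc i) mod 6 \<in> (if \<not> b then {0, 5} else {2, 3})"
        by (auto simp: mod_Suc)
      then show thesis using that by blast
    qed
    then show ?thesis
    proof cases
      case 1
      then show ?thesis using internal by (subst (1) v, subst pos_D) auto
    next
      case 2
      then show ?thesis using *[of i] internal by auto
    next
      case 3
      then show ?thesis using *[of "Suc (Suc i)"] internal by auto
    qed
  qed
  have "card (D True) + card (D False) = 3 * n + 2 * (m * (2 * j + 1))"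
  proof -
    have "(\<Sum>e<m. \<Sum>i<q. of_bool (pos e (Suc i) \<in> D True)) + (\<Sum>e<m. \<Sum>i<q. of_bool (pos e (Suc i) \<in> D False))
      = (\<Sum>e<m. \<Sum>i<q. of_bool (Suc i mod 6 \<in> {0, 5}) + of_bool (Suc i mod 6 \<in> {2, 3}) :: nat)"
      unfolding sum.distrib[symmetric] by (intro sum.cong refl) (simp add: pos_D)
    also have "\<dots> = m * (2 * (2 * j + 1))"
      unfolding q_def sum_of_bool_mod_6 by simp
    finally have "(\<Sum>e<m. \<Sum>i<q. of_bool (pos e (Suc i) \<in> D True))
      + (\<Sum>e<m. \<Sum>i<q. of_bool (pos e (Suc i) \<in> D False)) = m * (2 * (2 * j + 1))" .
    moreover have "(\<Sum>v<n. of_bool (v \<in> D b) + of_bool (n + v \<in> D b) + of_bool (2 * n + v \<in> D b))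
      = n * (if b then 2 else 1)" for b
      by (simp add: V_D)
    ultimately show ?thesis unfolding card_vertices[OF sub] by simp
  qed
  then show ?thesis
    using sub dom[of _ True] dom[of _ False] by (intro exI[of _ "D True"] exI[of _ "D False"]) simp
qed

section \<open>Local 2-colourings\<close>

text \<open>\<open>d\<close> is the distance from \<open>v\<close>, cut off at \<open>K\<close>, and
  its parity is the colouring. An edge between two vertices at the same distance k < K would close
  an odd walk of length 2 k + 1 < 2 K through \<open>v\<close>. No claim is made for edges with both
  ends at the cut-off.\<close>

lemma base_layering:
  assumes odd_walks: "\<forall>x es. set es \<subseteq> {..<m} \<and> walk f x es x \<and> odd (length es) \<longrightarrow> 2 * K < length es"
  shows "\<exists>(d :: nat \<Rightarrow> nat) (s :: nat \<Rightarrow> bool). d v = 0 \<and> (\<forall>u. d u \<le> K) \<and>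
    (\<forall>e<m. d (fst (f e)) \<le> Suc (d (snd (f e))) \<and> d (snd (f e)) \<le> Suc (d (fst (f e)))) \<and>
    (\<forall>e<m. d (fst (f e)) < K \<or> d (snd (f e)) < K \<longrightarrow> s (fst (f e)) \<noteq> s (snd (f e)))"
proof -
  define near where "near k u \<longleftrightarrow> (\<exists>es. set es \<subseteq> {..<m} \<and> length es = k \<and> walk f v es u)" for k u
  \<comment> \<open>The alternative \<open>k = K\<close> realises the cut-off and also serves
    unreachable vertices.\<close>
  define d where "d u = (LEAST k. near k u \<or> k = K)" for u
  have near_step: "near (Suc k) u'" if "near k u" "e < m" "joins f e u u'" for k u u' e
  proof -
    from that(1) obtain es where "set es \<subseteq> {..<m}" "length es = k" "walk f v es u"
      by (auto simp: near_def)
    then show ?thesis unfolding near_def using that(2,3)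
      by (intro exI[of _ "es @ [e]"]) (auto simp: walk_append)
  qed
  have d_near: "near (d u) u \<or> d u = K" for u
    unfolding d_def by (rule LeastI[of _ K]) simp
  have d_le: "d u \<le> k" if "near k u \<or> k = K" for u k
    unfolding d_def by (rule Least_le) (rule that)
  have step: "d u' \<le> Suc (d u)" if "e < m" "joins f e u u'" for e u u'
    using d_near[of u] d_le[of "Suc (d u)" u'] d_le[of K u'] near_step[OF _ that] by fastforce
  have flip: "odd (d u) \<noteq> odd (d u')" if "e < m" "joins f e u u'" "d u < K" for e u u'
  proof
    assume eq: "odd (d u) = odd (d u')"
    have "d u' \<le> Suc (d u)" "d u \<le> Suc (d u')"
      using step[OF that(1,2)] step[OF that(1), of u' u] that(2) by (auto simp: joins_sym)
    then have "d u' = d u \<or> d u' = Suc (d u) \<or> d u = Suc (d u')" by linarith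
    then have "d u' = d u" using eq by auto
    then have "near (d u) u" "near (d u) u'" using that(3) d_near[of u] d_near[of u'] by auto
    then obtain es es' where es: "set es \<subseteq> {..<m}" "length es = d u" "walk f v es u"
      and es': "set es' \<subseteq> {..<m}" "length es' = d u" "walk f v es' u'"
      by (auto simp: near_def)
    have "walk f v (es @ [e] @ rev es') v"
      using es(3) that(2) walk_rev[OF es'(3)] by (auto simp: walk_append)
    from odd_walks[rule_format, of "es @ [e] @ rev es'" v] this es es' that(1,3) show False by auto
  qed
  show ?thesis
  proof (intro exI[of _ d] exI[of _ "\<lambda>u. odd (d u)"] conjI allI impI)
    have "near 0 v" by (auto simp: near_def)
    then show "d v = 0" using d_le[of 0 v] by simp
    show "d u \<le> K" for u using d_le[of K u] by simp
  next
    fix e assume e: "e < m"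
    have j: "joins f e (fst (f e)) (snd (f e))" "joins f e (snd (f e)) (fst (f e))" by (auto simp: joins_def)
    show "d (fst (f e)) \<le> Suc (d (snd (f e)))" "d (snd (f e)) \<le> Suc (d (fst (f e)))"
      using step[OF e j(1)] step[OF e j(2)] by simp_all
    show "odd (d (fst (f e))) \<noteq> odd (d (snd (f e)))" if "d (fst (f e)) < K \<or> d (snd (f e)) < K"
      using that flip[OF e j(1)] flip[OF e j(2)] by blast
  qed
qed

text \<open>This is what the comparison of views needs: \<Phi> grows by at most 1 per edge, so r
  rounds starting from \<open>x\<close> stay within \<Phi> x + r, and the colouring alternates while
  this is below (q + 1) K. The start value can be as large as q + 1 because \<open>x\<close> may lie
  inside a path.\<close>

lemma layering:
  assumes odd_walks: "\<forall>x es. set es \<subseteq> {..<m} \<and> walk f x es x \<and> odd (length es) \<longrightarrow> 2 * K < length es"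
    and "x < base_size"
  obtains \<Phi> :: "nat \<Rightarrow> nat" and s :: "nat \<Rightarrow> bool" where "\<Phi> x \<le> Suc q"
    "\<And>u u'. {u, u'} \<in> edges \<Longrightarrow> \<Phi> u < Suc q * K \<Longrightarrow> (s u' \<longleftrightarrow> \<not> s u) \<and> \<Phi> u' \<le> Suc (\<Phi> u)"
proof -
  \<comment> \<open>The root is the original vertex of the pendant path of \<open>x\<close>, or the
    first end of the edge on whose path \<open>x\<close> lies.\<close>
  obtain v where v: "x = v \<and> v < n \<or> x = n + v \<and> v < n \<or> x = 2 * n + v \<and> v < n
    \<or> (\<exists>e<m. \<exists>i<q. x = internal e i \<and> v = fst (f e))"
    using assms(2) by (cases rule: vertex_cases) blast+
  obtain d :: "nat \<Rightarrow> nat" and s :: "nat \<Rightarrow> bool" where d0: "d v = 0" and ds: "\<forall>u. d u \<le> K"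
    "\<forall>e<m. d (fst (f e)) \<le> Suc (d (snd (f e))) \<and> d (snd (f e)) \<le> Suc (d (fst (f e)))"
    "\<forall>e<m. d (fst (f e)) < K \<or> d (snd (f e)) < K \<longrightarrow> s (fst (f e)) \<noteq> s (snd (f e))"
    using base_layering[OF odd_walks, of v] by blast
  from ds have dK: "d u \<le> K" for u by blast
  from ds have dstep: "d (fst (f e)) \<le> Suc (d (snd (f e))) \<and> d (snd (f e)) \<le> Suc (d (fst (f e)))"
    if "e < m" for e using that by blast
  from ds have sflip: "s (fst (f e)) \<noteq> s (snd (f e))"
    if "e < m" "d (fst (f e)) < K \<or> d (snd (f e)) < K" for e using that by blast
  \<comment> \<open>interpolating \<open>d\<close> linearly along the paths yields a 1-Lipschitz lower bound for distances from \<open>x\<close>\<close>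
  define \<Phi> where "\<Phi> = glue (\<lambda>v. Suc q * d v) (\<lambda>v. Suc q * d v) (\<lambda>v. Suc q * d v)
    (\<lambda>e i. (q - i) * d (fst (f e)) + Suc i * d (snd (f e)))"
  \<comment> \<open>The colour alternates along the pendant paths and along each path from its first
    end on. The internal vertex with index \<open>i\<close> has position i + 1, whence
    \<open>odd i\<close>.\<close>
  define t where "t = glue s (\<lambda>v. \<not> s v) s (\<lambda>e i. s (fst (f e)) = odd i)"
  have \<Phi>_pos: "\<Phi> (pos e i) = (Suc q - i) * d (fst (f e)) + i * d (snd (f e))" if "e < m" "i \<le> Suc q" for e i
    using that by (cases i) (simp_all add: \<Phi>_def glue_pos)
  have t_pos: "t (pos e i) = (s (fst (f e)) = even i)" if "e < m" "i \<le> q" for e i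
    using that by (cases i) (auto simp: t_def glue_pos)
  have t_end: "t (pos e (Suc q)) = s (snd (f e))" if "e < m" for e
    using that by (simp add: t_def glue_pos)
  have \<Phi>_step: "\<Phi> (pos e i) \<le> Suc (\<Phi> (pos e (Suc i))) \<and> \<Phi> (pos e (Suc i)) \<le> Suc (\<Phi> (pos e i))"
    if "e < m" "i \<le> q" for e i
  proof -
    have "Suc q - i = Suc (q - i)" using that(2) by simp
    then show ?thesis using \<Phi>_pos[of e i] \<Phi>_pos[of e "Suc i"] dstep[OF that(1)] that by auto
  qed
  have t_step: "t (pos e i) \<noteq> t (pos e (Suc i))"
    if "e < m" "i \<le> q" "\<Phi> (pos e i) < Suc q * K \<or> \<Phi> (pos e (Suc i)) < Suc q * K" for e i
  \<comment> \<open>Alternation can fail only at the last edge of a path. As q is even, it holds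
    there if the two ends of the path have different colours, and these can agree only if both ends
    are at the cut-off; then \<Phi> is constantly (q + 1) K on the path.\<close>
  proof (cases "i = q")
    case True
    have "d (fst (f e)) < K \<or> d (snd (f e)) < K"
    proof (rule ccontr)
      assume "\<not> ?thesis"
      then have "d (fst (f e)) = K" "d (snd (f e)) = K" using dK[of "fst (f e)"] dK[of "snd (f e)"] by auto
      then have "\<Phi> (pos e k) = Suc q * K" if "k \<le> Suc q" for k
        using \<Phi>_pos[OF \<open>e < m\<close> that] that by (simp flip: add_mult_distrib)
      then show False using that by auto
    qed
    from sflip[OF that(1) this] show ?thesis
      using t_pos[OF that(1,2)] t_end[OF that(1)] True by (auto simp: q_def)
  next
    case False
    then show ?thesis using t_pos[of e i] t_pos[of e "Suc i"] that by auto
  qed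
  show ?thesis
  proof (rule that[of \<Phi> t])
    from v show "\<Phi> x \<le> Suc q"
    proof (elim disjE exE conjE)
      fix e i assume e: "e < m" "i < q" "x = internal e i" "v = fst (f e)"
      then have "\<Phi> x = Suc i * d (snd (f e))" using d0 by (simp add: \<Phi>_def)
      also have "\<dots> \<le> Suc i * 1" using dstep[OF e(1)] d0 e(4) by (intro mult_left_mono) auto
      finally show ?thesis using e(2) by simp
    qed (auto simp: \<Phi>_def d0)
  next
    fix u u' assume "{u, u'} \<in> edges" "\<Phi> u < Suc q * K"
    then show "(t u' \<longleftrightarrow> \<not> t u) \<and> \<Phi> u' \<le> Suc (\<Phi> u)"
    proof (cases rule: edge_cases)
      case (path e i)
      then show ?thesis using t_step[of e i] \<Phi>_step[of e i] \<open>\<Phi> u < _\<close> by auto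
    next
      case (path' e i)
      then show ?thesis using t_step[of e i] \<Phi>_step[of e i] \<open>\<Phi> u < _\<close> by auto
    qed (auto simp: \<Phi>_def t_def)
  qed
qed

end

section \<open>Double covers and the coupling of executions\<close>

text \<open>\<open>lift_edges k False E\<close> consists of two disjoint copies of \<open>E\<close>, \<open>lift_edges k True E\<close> is its
  bipartite double cover. Vertices from \<open>2 * k\<close> on are isolated and serve as padding.\<close>

definition layer :: "nat \<Rightarrow> bool \<Rightarrow> nat \<Rightarrow> nat" where
  "layer k c u = (if c then k + u else u)"

definition lift_edges :: "nat \<Rightarrow> bool \<Rightarrow> nat set set \<Rightarrow> nat set set" where
  "lift_edges k b E = {{layer k c u, layer k (c \<noteq> b) v} | c u v. {u, v} \<in> E}"

text \<open>Inequality of truth values is exclusive or: every port of layer \<open>c\<close> leads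
  to layer \<open>c \<noteq> b\<close>, and port numbers are inherited from the base graph, so that
  the two lifts differ only in the layer that is reached.\<close>

definition lift_ports :: "nat \<Rightarrow> bool \<Rightarrow> (nat \<Rightarrow> nat \<Rightarrow> nat) \<Rightarrow> nat \<Rightarrow> nat \<Rightarrow> nat" where
  "lift_ports k b p x i = (if x < k then layer k b (p x i) else layer k (\<not> b) (p (x - k) i))"

lemma layer_inject: "u < k \<Longrightarrow> v < k \<Longrightarrow> layer k c u = layer k d v \<longleftrightarrow> c = d \<and> u = v"
  by (auto simp: layer_def)

lemma layer_less: "u < k \<Longrightarrow> layer k c u < 2 * k"
  by (simp add: layer_def)

lemma layer_cases:
  assumes "x < 2 * k"
  obtains c u where "u < k" "x = layer k c u"
  using assms that[of x False] that[of "x - k" True] by (cases "x < k") (auto simp: layer_def)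

lemma lift_ports_layer: "u < k \<Longrightarrow> lift_ports k b p (layer k c u) i = layer k (c \<noteq> b) (p u i)"
  by (auto simp: lift_ports_def layer_def)

lemma simple_graph_edge: 
  assumes "simple_graph k E" "{u, v} \<in> E"
  shows "u < k" "v < k" "u \<noteq> v"
  using assms by (fastforce simp: simple_graph_def)+

lemma finite_edges: "simple_graph n E \<Longrightarrow> finite E"
  by (rule finite_subset[of _ "Pow {..<n}"]) (auto simp: simple_graph_def)

context
  fixes k :: nat and E :: "nat set set"
  assumes simple: "simple_graph k E"
begin

lemma lift_edges_iff:
  assumes "u < k" "v < k"
  shows "{layer k c u, layer k d v} \<in> lift_edges k b E \<longleftrightarrow> d = (c \<noteq> b) \<and> {u, v} \<in> E"
proof
  assume "{layer k c u, layer k d v} \<in> lift_edges k b E"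
  then obtain c' u' v' where e: "{u', v'} \<in> E"
    "{layer k c u, layer k d v} = {layer k c' u', layer k (c' \<noteq> b) v'}"
    by (auto simp: lift_edges_def)
  then show "d = (c \<noteq> b) \<and> {u, v} \<in> E"
    using simple_graph_edge[OF simple e(1)] assms
    by (auto simp: doubleton_eq_iff layer_inject insert_commute)
qed (auto simp: lift_edges_def)

lemma lift_edges_less:
  assumes "{x, y} \<in> lift_edges k b E"
  shows "x < 2 * k" "y < 2 * k"
  using assms simple_graph_edge[OF simple] layer_less
  by (auto simp: lift_edges_def doubleton_eq_iff; metis)+

lemma simple_lift: "2 * k \<le> n \<Longrightarrow> simple_graph n (lift_edges k b E)"
  unfolding simple_graph_def
proof
  fix e assume n: "2 * k \<le> n" and "e \<in> lift_edges k b E"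
  then obtain c u v where e: "e = {layer k c u, layer k (c \<noteq> b) v}" "{u, v} \<in> E"
    by (auto simp: lift_edges_def)
  from simple_graph_edge[OF simple e(2)] show "e \<subseteq> {..<n} \<and> card e = 2"
    using n layer_less[of u k c] layer_less[of v k "c \<noteq> b"] unfolding e(1)
    by (auto simp: layer_inject)
qed

lemma nbrs_lift:
  assumes "u < k"
  shows "nbrs (lift_edges k b E) (layer k c u) = layer k (c \<noteq> b) ` nbrs E u"
proof (intro set_eqI iffI)
  fix x assume x: "x \<in> nbrs (lift_edges k b E) (layer k c u)"
  then have "x < 2 * k" using lift_edges_less by (auto simp: nbrs_def)
  then obtain d v where v: "v < k" "x = layer k d v" by (rule layer_cases)
  then have "d = (c \<noteq> b)" "{v, u} \<in> E"
    using x assms lift_edges_iff[of v u d c b] by (auto simp: nbrs_def)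
  then show "x \<in> layer k (c \<noteq> b) ` nbrs E u" using v by (auto simp: nbrs_def)
next
  fix x assume "x \<in> layer k (c \<noteq> b) ` nbrs E u"
  then obtain v where v: "{v, u} \<in> E" "x = layer k (c \<noteq> b) v" by (auto simp: nbrs_def)
  then show "x \<in> nbrs (lift_edges k b E) (layer k c u)"
    using lift_edges_iff[of v u "c \<noteq> b" c b] simple_graph_edge[OF simple v(1)] by (auto simp: nbrs_def)
qed

lemma nbrs_lift_isolated: "2 * k \<le> x \<Longrightarrow> nbrs (lift_edges k b E) x = {}"
  using lift_edges_less by (force simp: nbrs_def)

lemma nbrs_less: "v \<in> nbrs E u \<Longrightarrow> v < k"
  using simple_graph_edge[OF simple] by (auto simp: nbrs_def)

lemma inj_on_layer: "inj_on (layer k c) {..<k}"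
  by (auto simp: inj_on_def layer_inject)

lemma deg_lift: "u < k \<Longrightarrow> deg (lift_edges k b E) (layer k c u) = deg E u"
  unfolding deg_def using nbrs_less
  by (subst nbrs_lift) (auto intro!: card_image inj_on_subset[OF inj_on_layer])

lemma deg_lift_isolated: "2 * k \<le> x \<Longrightarrow> deg (lift_edges k b E) x = 0"
  by (simp add: deg_def nbrs_lift_isolated)

lemma port_numbering_lift:
  assumes p: "port_numbering k E p" and n: "2 * k \<le> n"
  shows "port_numbering n (lift_edges k b E) (lift_ports k b p)"
  unfolding port_numbering_def
proof (intro allI impI)
  fix x assume "x < n"
  show "bij_betw (lift_ports k b p x) {..<deg (lift_edges k b E) x} (nbrs (lift_edges k b E) x)"
  proof (cases "x < 2 * k")
    case True
    then obtain c u where u: "u < k" "x = layer k c u" by (rule layer_cases)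
    have "bij_betw (p u) {..<deg E u} (nbrs E u)" using p u by (simp add: port_numbering_def)
    moreover have "bij_betw (layer k (c \<noteq> b)) (nbrs E u) (layer k (c \<noteq> b) ` nbrs E u)"
      using nbrs_less by (intro inj_on_imp_bij_betw inj_on_subset[OF inj_on_layer]) auto
    ultimately have "bij_betw (layer k (c \<noteq> b) \<circ> p u) {..<deg E u} (layer k (c \<noteq> b) ` nbrs E u)"
      by (rule bij_betw_trans)
    moreover have "layer k (c \<noteq> b) \<circ> p u = lift_ports k b p x"
      using u by (auto simp: lift_ports_layer)
    ultimately show ?thesis using u by (simp add: nbrs_lift deg_lift)
  next
    case False
    then show ?thesis by (simp add: deg_lift_isolated nbrs_lift_isolated bij_betw_def)
  qed
qed

context
  fixes p :: "nat \<Rightarrow> nat \<Rightarrow> nat"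
  assumes ports: "port_numbering k E p"
begin

lemma port_edge: "u < k \<Longrightarrow> i < deg E u \<Longrightarrow> {u, p u i} \<in> E"
  using ports by (auto simp: port_numbering_def bij_betw_def nbrs_def insert_commute)

lemma port_less: "u < k \<Longrightarrow> i < deg E u \<Longrightarrow> p u i < k"
  using port_edge simple_graph_edge[OF simple] by blast

text \<open>The sender's port enters the message, and it is inherited from the base graph as
  well.\<close>

lemma port_towards_lift:
  assumes "u < k" "i < deg E u"
  shows "port_towards (lift_edges k b E) (lift_ports k b p) (layer k (c \<noteq> b) (p u i)) (layer k c u)
    = port_towards E p (p u i) u"
proof -
  have v: "p u i < k" using assms by (rule port_less)
  have "j < deg (lift_edges k b E) (layer k (c \<noteq> b) (p u i)) \<and>
      lift_ports k b p (layer k (c \<noteq> b) (p u i)) j = layer k c u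
    \<longleftrightarrow> j < deg E (p u i) \<and> p (p u i) j = u" for j
  proof (cases "j < deg E (p u i)")
    case True
    then show ?thesis using v assms port_less[OF v True]
      by (auto simp: deg_lift lift_ports_layer layer_inject)
  next
    case False
    then show ?thesis using v by (simp add: deg_lift)
  qed
  then show ?thesis by (simp add: port_towards_def)
qed

lemma state_lift_Suc:
  assumes "u < k"
  shows "state_after A n (lift_edges k b E) (lift_ports k b p) w (Suc t) (layer k c u)
    = receive A (state_after A n (lift_edges k b E) (lift_ports k b p) w t (layer k c u))
       (map (\<lambda>i. send A (state_after A n (lift_edges k b E) (lift_ports k b p) w t (layer k (c \<noteq> b) (p u i)))
           (port_towards E p (p u i) u)) [0..<deg E u])"
  using assms by (auto simp: deg_lift lift_ports_layer port_towards_lift[simplified] intro!: arg_cong2[where f = "receive A"])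

text \<open>Within distance \<open>T\<close> of the root (measured by \<open>\<Phi>\<close>) the 2-colouring \<open>s\<close> is proper, so exchanging the
  layers where \<open>s\<close> holds maps one lift to the other there.\<close>

lemma state_lift_coupling:
  assumes s: "\<And>u u'. {u, u'} \<in> E \<Longrightarrow> \<Phi> u < T \<Longrightarrow> (s u' \<longleftrightarrow> \<not> s u) \<and> \<Phi> u' \<le> Suc (\<Phi> u)"
    and w: "\<And>c u. u < k \<Longrightarrow> w' (layer k c u) = w (layer k (c \<noteq> s u) u)"
  shows "u < k \<Longrightarrow> \<Phi> u + t \<le> T \<Longrightarrow>
    state_after A n (lift_edges k True E) (lift_ports k True p) w t (layer k (c \<noteq> s u) u)
    = state_after A n (lift_edges k False E) (lift_ports k False p) w' t (layer k c u)"
proof (induction t arbitrary: u c)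
  case 0
  then show ?case by (simp add: deg_lift w)
next
  case (Suc t)
  have IH: "state_after A n (lift_edges k True E) (lift_ports k True p) w t (layer k ((c \<noteq> s u) \<noteq> True) (p u i))
    = state_after A n (lift_edges k False E) (lift_ports k False p) w' t (layer k (c \<noteq> False) (p u i))"
    if i: "i < deg E u" for i
  proof -
    have "(s (p u i) \<longleftrightarrow> \<not> s u) \<and> \<Phi> (p u i) \<le> Suc (\<Phi> u)"
      using Suc.prems i by (intro s port_edge) auto
    \<comment> \<open>Crossing an edge of the double cover flips the layer, and the colour
      \<open>s\<close> flips along the same edge. The two flips cancel, so the correspondence of
      layers persists at the neighbour, with one unit of the budget \<open>T\<close> spent.\<close>
    then have eq: "((c \<noteq> s u) \<noteq> True) = (c \<noteq> s (p u i))" "\<Phi> (p u i) + t \<le> T"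
      using Suc.prems by auto
    show ?thesis unfolding eq(1)
      using Suc.IH[OF port_less[OF Suc.prems(1) i] eq(2), of c] by simp
  qed
  have "state_after A n (lift_edges k True E) (lift_ports k True p) w t (layer k (c \<noteq> s u) u)
    = state_after A n (lift_edges k False E) (lift_ports k False p) w' t (layer k c u)"
    using Suc.prems by (intro Suc.IH) auto
  then show ?case unfolding state_lift_Suc[OF Suc.prems(1)] using IH
    by (auto intro!: arg_cong2[where f = "receive A"])
qed

lemma state_isolated:
  assumes "2 * k \<le> x"
  shows "state_after A n (lift_edges k b E) q w t x = state_after A n (lift_edges k b' E) q' w t x"
  by (induction t) (simp_all add: deg_lift_isolated assms)

end

end

section \<open>Invariance of the random bits under exchange of layers\<close>

lemma prob_space_random_bits: "prob_space (random_bits n)"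
  unfolding random_bits_def by (intro prob_space_PiM measure_pmf.prob_space_axioms)

lemma distr_random_bits_permute:
  assumes "\<pi> permutes {..<n}"
  shows "distr (random_bits n) (random_bits n) (\<lambda>w. \<lambda>v\<in>{..<n}. w (\<pi> v)) = random_bits n"
proof -
  have "inj_on \<pi> {..<n}" "\<pi> \<in> {..<n} \<rightarrow> {..<n}"
    using permutes_inj_on[OF assms] permutes_in_image[OF assms] by auto
  then show ?thesis unfolding random_bits_def
    by (intro distr_PiM_reindex[where M = "\<lambda>_. \<Pi>\<^sub>M i\<in>UNIV. measure_pmf (bernoulli_pmf (1/2))"]
      prob_space_PiM measure_pmf.prob_space_axioms)
qed

lemma measurable_random_bits_permute:
  assumes "\<pi> permutes {..<n}"
  shows "(\<lambda>w. \<lambda>v\<in>{..<n}. w (\<pi> v)) \<in> random_bits n \<rightarrow>\<^sub>M random_bits n"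
  unfolding random_bits_def
  by (rule measurable_restrict) (use permutes_in_image[OF assms] in \<open>auto intro: measurable_component_singleton\<close>)

definition layer_swap :: "nat \<Rightarrow> (nat \<Rightarrow> bool) \<Rightarrow> nat \<Rightarrow> nat" where
  "layer_swap k s x = (if x < k then layer k (s x) x
    else if x < 2 * k then layer k (\<not> s (x - k)) (x - k) else x)"

lemma layer_swap_layer: "u < k \<Longrightarrow> layer_swap k s (layer k c u) = layer k (c \<noteq> s u) u"
  by (auto simp: layer_swap_def layer_def)

lemma layer_swap_permutes:
  assumes "2 * k \<le> n"
  shows "layer_swap k s permutes {..<n}"
proof -
  have "layer_swap k s (layer_swap k s x) = x" for x
  proof (cases "x < 2 * k")
    case True
    then obtain c u where "u < k" "x = layer k c u" by (rule layer_cases)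
    then show ?thesis by (cases c; cases "s u") (simp_all add: layer_swap_layer)
  qed (auto simp: layer_swap_def)
  then have "bij (layer_swap k s)" by (rule involuntory_imp_bij)
  moreover have "layer_swap k s x = x" if "x \<notin> {..<n}" for x
    using that assms by (auto simp: layer_swap_def)
  ultimately show ?thesis unfolding permutes_def bij_iff by blast
qed

text \<open>By the coupling, the output on the double cover with bits \<open>w\<close> is the output
  on the two copies with the permuted bits \<open>g w\<close>, and \<open>g\<close> preserves the
  measure. Colouring and permutation depend on \<open>x\<close>, so single outputs are compared and
  not joint ones.\<close>

lemma prob_output_lift:
  fixes A :: "'o local_alg"
  assumes simple: "simple_graph k E" and ports: "port_numbering k E p" and n: "2 * k \<le> n"
    and x: "x < k" "\<Phi> x + rounds A n \<le> T"
    and s: "\<And>u u'. {u, u'} \<in> E \<Longrightarrow> \<Phi> u < T \<Longrightarrow> (s u' \<longleftrightarrow> \<not> s u) \<and> \<Phi> u' \<le> Suc (\<Phi> u)"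
    and meas: "\<And>c. {w \<in> space (random_bits n).
      Q (final_output A n (lift_edges k False E) (lift_ports k False p) w (layer k c x))} \<in> sets (random_bits n)"
  shows "measure (random_bits n) {w \<in> space (random_bits n).
      Q (final_output A n (lift_edges k True E) (lift_ports k True p) w (layer k (c \<noteq> s x) x))}
    = measure (random_bits n) {w \<in> space (random_bits n).
      Q (final_output A n (lift_edges k False E) (lift_ports k False p) w (layer k c x))}"
proof -
  define \<pi> where "\<pi> = layer_swap k s"
  have \<pi>: "\<pi> permutes {..<n}" unfolding \<pi>_def by (rule layer_swap_permutes[OF n])
  define g where "g w = (\<lambda>v\<in>{..<n}. w (\<pi> v))" for w :: "nat \<Rightarrow> bits"
  have g: "g \<in> random_bits n \<rightarrow>\<^sub>M random_bits n" "distr (random_bits n) (random_bits n) g = random_bits n"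
    unfolding g_def using measurable_random_bits_permute[OF \<pi>] distr_random_bits_permute[OF \<pi>] by auto
  let ?F = "{w \<in> space (random_bits n).
      Q (final_output A n (lift_edges k False E) (lift_ports k False p) w (layer k c x))}"
  have g_layer: "g w (layer k c u) = w (layer k (c \<noteq> s u) u)" if "u < k" for w c u
    using that layer_less[OF that, of c] n by (simp add: g_def \<pi>_def layer_swap_layer)
  have "final_output A n (lift_edges k True E) (lift_ports k True p) w (layer k (c \<noteq> s x) x)
    = final_output A n (lift_edges k False E) (lift_ports k False p) (g w) (layer k c x)" for w
    unfolding final_output_def
    by (rule arg_cong[where f = "outcome A"],
      rule state_lift_coupling[where s = s and \<Phi> = \<Phi> and T = T and w' = "g w" and w = w,
        OF simple ports s g_layer x])
  then have eq: "{w \<in> space (random_bits n).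
      Q (final_output A n (lift_edges k True E) (lift_ports k True p) w (layer k (c \<noteq> s x) x))}
    = g -` ?F \<inter> space (random_bits n)"
    using measurable_space[OF g(1)] by auto
  show ?thesis
    unfolding eq measure_distr[symmetric, OF g(1) meas] g(2) ..
qed

section \<open>Expected sizes as sums of marginals\<close>

text \<open>Linearity of expectation reduces the expected size to marginal probabilities, which are
  all that the coupling controls.\<close>

lemma expected_size_eq_sum:
  assumes "prob_space M" "random_set M X" "finite U" "\<And>w. w \<in> space M \<Longrightarrow> X w \<subseteq> U"
  shows "integrable M (\<lambda>w. real (card (X w)))"
    and "expected_size M X = (\<Sum>x\<in>U. measure M {w \<in> space M. x \<in> X w})"
proof -
  interpret prob_space M by (rule assms(1))
  have sets: "{w \<in> space M. x \<in> X w} \<in> sets M" for x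
    using assms(2) by (simp add: random_set_def)
  have eq: "real (card (X w)) = (\<Sum>x\<in>U. indicator {w \<in> space M. x \<in> X w} w)" if "w \<in> space M" for w
  proof -
    have "U \<inter> {x. x \<in> X w} = X w" using assms(4)[OF that] by auto
    then show ?thesis using that assms(3) by (simp add: indicator_def sum_of_bool_eq)
  qed
  have int: "integrable M (\<lambda>w. \<Sum>x\<in>U. indicator {w \<in> space M. x \<in> X w} w :: real)"
    by (intro Bochner_Integration.integrable_sum integrable_real_indicator sets emeasure_finite) (simp add: emeasure_eq_measure)
  then show "integrable M (\<lambda>w. real (card (X w)))"
    using eq by (subst Bochner_Integration.integrable_cong[OF refl]) auto
  have "expected_size M X = (\<integral>w. (\<Sum>x\<in>U. indicator {w \<in> space M. x \<in> X w} w) \<partial>M)"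
    unfolding expected_size_def by (intro Bochner_Integration.integral_cong refl eq)
  also have "\<dots> = (\<Sum>x\<in>U. measure M {w \<in> space M. x \<in> X w})"
  proof (subst Bochner_Integration.integral_sum)
    show "integrable M (indicator {w \<in> space M. x \<in> X w} :: _ \<Rightarrow> real)" for x
      by (intro integrable_real_indicator sets) (simp add: emeasure_eq_measure)
    have "{w \<in> space M. x \<in> X w} \<inter> space M = {w \<in> space M. x \<in> X w}" for x by auto
    then show "(\<Sum>x\<in>U. \<integral>w. indicator {w \<in> space M. x \<in> X w} w \<partial>M)
      = (\<Sum>x\<in>U. measure M {w \<in> space M. x \<in> X w})"
      by (simp only: Bochner_Integration.integral_indicator)
  qed
  finally show "expected_size M X = (\<Sum>x\<in>U. measure M {w \<in> space M. x \<in> X w})" .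
qed

lemma expected_size_bounds:
  assumes "prob_space M" "random_set M X" "finite U" "\<And>w. w \<in> space M \<Longrightarrow> X w \<subseteq> U"
  shows "(\<And>w. w \<in> space M \<Longrightarrow> real (card (X w)) \<le> B) \<Longrightarrow> expected_size M X \<le> B"
    and "(\<And>w. w \<in> space M \<Longrightarrow> B \<le> real (card (X w))) \<Longrightarrow> B \<le> expected_size M X"
proof -
  interpret prob_space M by (rule assms(1))
  note int = expected_size_eq_sum(1)[OF assms]
  show "(\<And>w. w \<in> space M \<Longrightarrow> real (card (X w)) \<le> B) \<Longrightarrow> expected_size M X \<le> B"
    unfolding expected_size_def by (intro integral_le_const int AE_I2)
  show "(\<And>w. w \<in> space M \<Longrightarrow> B \<le> real (card (X w))) \<Longrightarrow> B \<le> expected_size M X"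
    unfolding expected_size_def by (intro integral_ge_const int AE_I2)
qed

lemma sum_layers:
  assumes "2 * k \<le> n"
  shows "(\<Sum>x<n. g x) = (\<Sum>u<k. g (layer k False u) + g (layer k True u)) + (\<Sum>x\<in>{2 * k..<n}. g x)"
proof -
  have "{..<n} = {..<k + k} \<union> {2 * k..<n}" using assms by auto
  then have "(\<Sum>x<n. g x) = sum g ({..<k + k} \<union> {2 * k..<n})" by (rule arg_cong)
  also have "\<dots> = (\<Sum>x<k + k. g x) + (\<Sum>x\<in>{2 * k..<n}. g x)"
    by (rule sum.union_disjoint) auto
  also have "(\<Sum>x<k + k. g x) = (\<Sum>u<k. g u) + (\<Sum>u<k. g (k + u))"
  proof -
    have "(\<Sum>x<k + l. g x) = (\<Sum>u<k. g u) + (\<Sum>u<l. g (k + u))" for l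
      by (induction l) (auto simp: add.assoc)
    then show ?thesis .
  qed
  finally show ?thesis by (simp add: layer_def sum.distrib)
qed

text \<open>The exchange \<open>b\<close> may vary with the base vertex, but it only permutes the
  two summands above \<open>u\<close>.\<close>

lemma sum_layers_eq:
  assumes "2 * k \<le> n" "\<And>u. u < k \<Longrightarrow> \<exists>b. \<forall>c. g (layer k (c \<noteq> b) u) = h (layer k c u)"
    and "\<And>x. 2 * k \<le> x \<Longrightarrow> g x = h x"
  shows "(\<Sum>x<n. g x) = (\<Sum>x<n. h x)"
proof -
  have "g (layer k False u) + g (layer k True u) = h (layer k False u) + h (layer k True u)" if "u < k" for u
  proof -
    obtain b where b: "\<And>c. g (layer k (c \<noteq> b) u) = h (layer k c u)" using assms(2)[OF \<open>u < k\<close>] by blast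
    show ?thesis using b[of False] b[of True] by (cases b) (simp_all add: add.commute)
  qed
  then show ?thesis unfolding sum_layers[OF assms(1)] using assms(3) by simp
qed

lemma card_layers:
  assumes "2 * k \<le> n" "X \<subseteq> {..<n}"
  shows "card X = card {u. u < k \<and> layer k False u \<in> X} + card {u. u < k \<and> layer k True u \<in> X}
    + card (X \<inter> {2 * k..<n})"
proof -
  have "card {u. u < k \<and> layer k c u \<in> X} = (\<Sum>u<k. of_bool (layer k c u \<in> X))" for c
    by (subst card_eq_sum_of_bool[of _ k]) (auto intro!: sum.cong)
  moreover have "card (X \<inter> {2 * k..<n}) = (\<Sum>x\<in>{2 * k..<n}. of_bool (x \<in> X))"
    by (subst sum_of_bool_eq) (auto simp: Int_commute)
  ultimately show ?thesis
    unfolding card_eq_sum_of_bool[OF assms(2)] sum_layers[OF assms(1)] by (simp add: sum.distrib)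
qed

text \<open>Algorithms report an edge through ports at both of its ends, while a solution counts it
  once; the factor 2 translates between the two.\<close>

lemma sum_darts:
  fixes h :: "nat set \<Rightarrow> 'a :: comm_semiring_1"
  assumes simple: "simple_graph n E" and ports: "port_numbering n E p"
  shows "(\<Sum>x<n. \<Sum>i<deg E x. h {x, p x i}) = 2 * (\<Sum>e\<in>E. h e)"
proof -
  have finE: "finite E" by (rule finite_edges[OF simple])
  have nbrs: "nbrs E x \<subseteq> {..<n}" for x using simple_graph_edge[OF simple] by (auto simp: nbrs_def)
  then have fin_nbrs: "finite (nbrs E x)" for x using finite_subset by blast
  define D where "D = Sigma {..<n} (nbrs E)"
  have "(\<Sum>x<n. \<Sum>i<deg E x. h {x, p x i}) = (\<Sum>x<n. \<Sum>y\<in>nbrs E x. h {x, y})"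
  proof (rule sum.cong[OF refl])
    fix x assume "x \<in> {..<n}"
    then have "bij_betw (p x) {..<deg E x} (nbrs E x)" using ports by (simp add: port_numbering_def)
    then show "(\<Sum>i<deg E x. h {x, p x i}) = (\<Sum>y\<in>nbrs E x. h {x, y})"
      by (rule sum.reindex_bij_betw[where g = "\<lambda>y. h {x, y}"])
  qed
  also have "\<dots> = (\<Sum>(x, y)\<in>D. h {x, y})"
    unfolding D_def by (rule sum.Sigma) (use fin_nbrs in auto)
  also have "\<dots> = (\<Sum>e\<in>E. \<Sum>d\<in>{d\<in>D. {fst d, snd d} = e}. h {fst d, snd d})"
  proof -
    have "finite D" unfolding D_def using fin_nbrs by auto
    moreover have "(\<lambda>d. {fst d, snd d}) ` D \<subseteq> E" by (auto simp: D_def nbrs_def insert_commute)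
    ultimately show ?thesis
      using sum.group[of D E "\<lambda>d. {fst d, snd d}" "\<lambda>d. h {fst d, snd d}"] finE
      by (simp add: case_prod_beta)
  qed
  also have "\<dots> = (\<Sum>e\<in>E. 2 * h e)"
  proof (rule sum.cong[OF refl])
    fix e assume e: "e \<in> E"
    then obtain a b where ab: "e = {a, b}" "a \<noteq> b"
      using simple by (auto simp: simple_graph_def card_2_iff)
    have "a < n" "b < n" using e ab simple_graph_edge[OF simple] by auto
    then have "{d\<in>D. {fst d, snd d} = e} = {(a, b), (b, a)}"
      using e ab by (auto simp: D_def nbrs_def doubleton_eq_iff insert_commute)
    then have "(\<Sum>d\<in>{d\<in>D. {fst d, snd d} = e}. h {fst d, snd d}) = h {a, b} + h {b, a}"
      using ab by simp
    then show "(\<Sum>d\<in>{d\<in>D. {fst d, snd d} = e}. h {fst d, snd d}) = 2 * h e"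
      using ab by (simp add: insert_commute mult_2)
  qed
  finally show ?thesis by (simp add: sum_distrib_left)
qed

lemma handshake:
  assumes "simple_graph n E" "port_numbering n E p"
  shows "(\<Sum>x<n. deg E x) = 2 * card E"
  using sum_darts[OF assms, of "\<lambda>_. 1 :: nat"] by simp

text \<open>An edge can enter \<open>edge_solution\<close> through the port at its other end; edge
  agreement makes the two reports equal.\<close>

lemma edge_solution_iff:
  assumes simple: "simple_graph n E" and ports: "port_numbering n E p"
    and agree: "edge_agreement A n E p w" and x: "x < n" "i < deg E x"
  shows "{x, p x i} \<in> edge_solution A n E p w \<longleftrightarrow> final_output A n E p w x i"
proof
  have inj: "j = l" if "v < n" "j < deg E v" "l < deg E v" "p v j = p v l" for v j l
    using ports that by (auto simp: port_numbering_def bij_betw_def inj_on_def)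
  assume "{x, p x i} \<in> edge_solution A n E p w"
  then obtain v j where v: "{x, p x i} = {v, p v j}" "v < n" "j < deg E v" "final_output A n E p w v j"
    by (auto simp: edge_solution_def)
  from v(1) consider "x = v" "p x i = p v j" | "x = p v j" "p x i = v" by (auto simp: doubleton_eq_iff)
  then show "final_output A n E p w x i"
  proof cases
    case 1
    then show ?thesis using v inj[of x i j] x by auto
  next
    case 2
    have "port_towards E p x v = i"
      unfolding port_towards_def by (rule the_equality) (use 2 x inj in auto)
    then show ?thesis using agree v 2 by (auto simp: edge_agreement_def)
  qed
next
  assume "final_output A n E p w x i"
  then show "{x, p x i} \<in> edge_solution A n E p w" using x by (auto simp: edge_solution_def)
qed

lemma edge_solution_subset:
  assumes "port_numbering n E p"
  shows "edge_solution A n E p w \<subseteq> E"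
  using assms by (auto simp: edge_solution_def port_numbering_def bij_betw_def nbrs_def insert_commute)

section \<open>Equal expectations on the two lifts\<close>

context
  fixes k n T :: nat and E :: "nat set set" and p :: "nat \<Rightarrow> nat \<Rightarrow> nat" and A :: "'o local_alg"
  assumes simple: "simple_graph k E" and ports: "port_numbering k E p" and n: "2 * k \<le> n"
    and layering: "\<forall>x<k. \<exists>(\<Phi> :: nat \<Rightarrow> nat) s. \<Phi> x + rounds A n \<le> T \<and>
      (\<forall>u u'. {u, u'} \<in> E \<and> \<Phi> u < T \<longrightarrow> (s u' \<longleftrightarrow> \<not> s u) \<and> \<Phi> u' \<le> Suc (\<Phi> u))"
begin

text \<open>\<open>b\<close> is chosen before the layer \<open>c\<close> and the index
  \<open>i\<close>, so one exchange serves both layers and all ports of \<open>u\<close>. In edge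
  problems the index is the port; vertex problems use a one-point index set.\<close>

lemma prob_output_layers:
  fixes R :: "'i \<Rightarrow> 'o \<Rightarrow> bool"
  assumes u: "u < k" and meas: "\<And>c i. i \<in> J \<Longrightarrow> {w \<in> space (random_bits n).
      R i (final_output A n (lift_edges k False E) (lift_ports k False p) w (layer k c u))} \<in> sets (random_bits n)"
  shows "\<exists>b. \<forall>c. \<forall>i\<in>J. measure (random_bits n) {w \<in> space (random_bits n).
      R i (final_output A n (lift_edges k True E) (lift_ports k True p) w (layer k (c \<noteq> b) u))}
    = measure (random_bits n) {w \<in> space (random_bits n).
      R i (final_output A n (lift_edges k False E) (lift_ports k False p) w (layer k c u))}"
proof -
  obtain \<Phi> :: "nat \<Rightarrow> nat" and s where \<Phi>: "\<Phi> u + rounds A n \<le> T"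
    and s: "\<forall>v v'. {v, v'} \<in> E \<and> \<Phi> v < T \<longrightarrow> (s v' \<longleftrightarrow> \<not> s v) \<and> \<Phi> v' \<le> Suc (\<Phi> v)"
    using layering u by blast
  show ?thesis
  proof (intro exI[of _ "s u"] allI ballI)
    fix c i assume i: "i \<in> J"
    show "measure (random_bits n) {w \<in> space (random_bits n).
      R i (final_output A n (lift_edges k True E) (lift_ports k True p) w (layer k (c \<noteq> s u) u))}
    = measure (random_bits n) {w \<in> space (random_bits n).
      R i (final_output A n (lift_edges k False E) (lift_ports k False p) w (layer k c u))}"
    proof (rule prob_output_lift[where \<Phi> = \<Phi> and T = T and s = s and Q = "R i" and p = p and E = E and k = k])
      show "simple_graph k E" "port_numbering k E p" "2 * k \<le> n" "u < k" by fact+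
      show "\<Phi> u + rounds A n \<le> T" by (rule \<Phi>)
      show "(s v' \<longleftrightarrow> \<not> s v) \<and> \<Phi> v' \<le> Suc (\<Phi> v)" if "{v, v'} \<in> E" "\<Phi> v < T" for v v'
        using s that by blast
      show "{w \<in> space (random_bits n).
          R i (final_output A n (lift_edges k False E) (lift_ports k False p) w (layer k c u))} \<in> sets (random_bits n)"
        for c by (rule meas[OF i])
    qed
  qed
qed

end

lemma expected_vertex_solution_lift:
  assumes simple: "simple_graph k E" and ports: "port_numbering k E p" and n: "2 * k \<le> n"
    and layering: "\<forall>x<k. \<exists>(\<Phi> :: nat \<Rightarrow> nat) s. \<Phi> x + rounds A n \<le> T \<and>
      (\<forall>u u'. {u, u'} \<in> E \<and> \<Phi> u < T \<longrightarrow> (s u' \<longleftrightarrow> \<not> s u) \<and> \<Phi> u' \<le> Suc (\<Phi> u))"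
    and meas: "\<And>b. random_set (random_bits n) (vertex_solution A n (lift_edges k b E) (lift_ports k b p))"
  shows "expected_size (random_bits n) (vertex_solution A n (lift_edges k True E) (lift_ports k True p))
    = expected_size (random_bits n) (vertex_solution A n (lift_edges k False E) (lift_ports k False p))"
proof -
  define out where "out b x w = final_output A n (lift_edges k b E) (lift_ports k b p) w x" for b x w
  define g where "g b x = measure (random_bits n) {w \<in> space (random_bits n). out b x w}" for b x
  have out_iff: "{w \<in> space (random_bits n). x \<in> vertex_solution A n (lift_edges k b E) (lift_ports k b p) w}
    = {w \<in> space (random_bits n). out b x w}" if "x < n" for x b
    using that by (simp add: vertex_solution_def out_def)
  have size_eq: "expected_size (random_bits n) (vertex_solution A n (lift_edges k b E) (lift_ports k b p))
    = (\<Sum>x<n. g b x)" for b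
  proof -
    have "expected_size (random_bits n) (vertex_solution A n (lift_edges k b E) (lift_ports k b p))
      = (\<Sum>x<n. measure (random_bits n) {w \<in> space (random_bits n).
          x \<in> vertex_solution A n (lift_edges k b E) (lift_ports k b p) w})"
      by (rule expected_size_eq_sum(2)[OF prob_space_random_bits meas]) (auto simp: vertex_solution_def)
    also have "\<dots> = (\<Sum>x<n. g b x)"
      by (rule sum.cong) (simp_all add: g_def out_iff)
    finally show ?thesis .
  qed
  have "(\<Sum>x<n. g True x) = (\<Sum>x<n. g False x)"
  proof (rule sum_layers_eq[OF n])
    fix u assume u: "u < k"
    have out_meas: "{w \<in> space (random_bits n). out False (layer k c u) w} \<in> sets (random_bits n)" for c
    proof -
      have "layer k c u < n" using layer_less[OF u, of c] n by linarith
      then show ?thesis using meas[of False] by (simp only: random_set_def flip: out_iff)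
    qed
    obtain b where "\<forall>c. \<forall>i\<in>{()}. measure (random_bits n) {w \<in> space (random_bits n). out True (layer k (c \<noteq> b) u) w}
      = measure (random_bits n) {w \<in> space (random_bits n). out False (layer k c u) w}"
      using prob_output_layers[OF simple ports n layering u, where J = "{()}" and R = "\<lambda>_ x. x", folded out_def, OF out_meas]
      by (elim exE)
    then show "\<exists>b. \<forall>c. g True (layer k (c \<noteq> b) u) = g False (layer k c u)"
      unfolding g_def by blast
  next
    fix x assume x: "2 * k \<le> x"
    show "g True x = g False x"
      unfolding g_def out_def final_output_def 
        state_isolated[OF simple ports x, where b = True and b' = False
          and q = "lift_ports k True p" and q' = "lift_ports k False p"] ..
  qed
  then show ?thesis unfolding size_eq .
qed

text \<open>The doubled expectation is a sum over vertices and ports. Corresponding vertices have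
  the same ports, so the exchange of layers matches the inner sums term by term; isolated vertices
  contribute nothing.\<close>

lemma expected_edge_solution_lift:
  assumes simple: "simple_graph k E" and ports: "port_numbering k E p" and n: "2 * k \<le> n"
    and layering: "\<forall>x<k. \<exists>(\<Phi> :: nat \<Rightarrow> nat) s. \<Phi> x + rounds A n \<le> T \<and>
      (\<forall>u u'. {u, u'} \<in> E \<and> \<Phi> u < T \<longrightarrow> (s u' \<longleftrightarrow> \<not> s u) \<and> \<Phi> u' \<le> Suc (\<Phi> u))"
    and meas: "\<And>b. random_set (random_bits n) (edge_solution A n (lift_edges k b E) (lift_ports k b p))"
    and agree: "\<And>b w. w \<in> space (random_bits n) \<Longrightarrow> edge_agreement A n (lift_edges k b E) (lift_ports k b p) w"
  shows "expected_size (random_bits n) (edge_solution A n (lift_edges k True E) (lift_ports k True p))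
    = expected_size (random_bits n) (edge_solution A n (lift_edges k False E) (lift_ports k False p))"
proof -
  define out where "out b x w = final_output A n (lift_edges k b E) (lift_ports k b p) w x" for b x w
  define g where "g b x = (\<Sum>i<deg (lift_edges k b E) x.
    measure (random_bits n) {w \<in> space (random_bits n). out b x w i})" for b x
  note simple' = simple_lift[OF simple n] and ports' = port_numbering_lift[OF simple ports n]
  have out_iff: "{w \<in> space (random_bits n). {x, lift_ports k b p x i} \<in> edge_solution A n (lift_edges k b E) (lift_ports k b p) w}
    = {w \<in> space (random_bits n). out b x w i}"
    if "x < n" "i < deg (lift_edges k b E) x" for x b i
    using edge_solution_iff[OF simple' ports' agree that] by (auto simp: out_def)
  have size_eq: "2 * expected_size (random_bits n) (edge_solution A n (lift_edges k b E) (lift_ports k b p))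
    = (\<Sum>x<n. g b x)" for b
  proof -
    have "expected_size (random_bits n) (edge_solution A n (lift_edges k b E) (lift_ports k b p))
      = (\<Sum>e\<in>lift_edges k b E. measure (random_bits n) {w \<in> space (random_bits n).
          e \<in> edge_solution A n (lift_edges k b E) (lift_ports k b p) w})"
      by (rule expected_size_eq_sum(2)[OF prob_space_random_bits meas finite_edges[OF simple']])
        (rule edge_solution_subset[OF ports'])
    then have "2 * expected_size (random_bits n) (edge_solution A n (lift_edges k b E) (lift_ports k b p))
      = (\<Sum>x<n. \<Sum>i<deg (lift_edges k b E) x. measure (random_bits n) {w \<in> space (random_bits n).
          {x, lift_ports k b p x i} \<in> edge_solution A n (lift_edges k b E) (lift_ports k b p) w})"
      by (simp only: sum_darts[OF simple' ports', of "\<lambda>e. measure (random_bits n) {w \<in> space (random_bits n).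
          e \<in> edge_solution A n (lift_edges k b E) (lift_ports k b p) w}"])
    also have "\<dots> = (\<Sum>x<n. g b x)"
      unfolding g_def by (intro sum.cong refl) (simp add: out_iff)
    finally show ?thesis .
  qed
  have "(\<Sum>x<n. g True x) = (\<Sum>x<n. g False x)"
  proof (rule sum_layers_eq[OF n])
    fix u assume u: "u < k"
    have out_meas: "{w \<in> space (random_bits n). out False (layer k c u) w i} \<in> sets (random_bits n)"
      if "i \<in> {..<deg E u}" for c i
    proof -
      have "layer k c u < n" using layer_less[OF u, of c] n by linarith
      moreover have "i < deg (lift_edges k False E) (layer k c u)" using that deg_lift[OF simple u] by simp
      ultimately show ?thesis using meas[of False] by (simp only: random_set_def flip: out_iff)
    qed
    have "\<exists>b. \<forall>c. \<forall>i\<in>{..<deg E u}.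
        measure (random_bits n) {w \<in> space (random_bits n). out True (layer k (c \<noteq> b) u) w i}
      = measure (random_bits n) {w \<in> space (random_bits n). out False (layer k c u) w i}"
      by (rule prob_output_layers[OF simple ports n layering u, where J = "{..<deg E u}" and R = "\<lambda>i f. f i",
          folded out_def, OF out_meas])
    then obtain b where "\<forall>c. \<forall>i\<in>{..<deg E u}.
        measure (random_bits n) {w \<in> space (random_bits n). out True (layer k (c \<noteq> b) u) w i}
      = measure (random_bits n) {w \<in> space (random_bits n). out False (layer k c u) w i}" ..
    then have "g True (layer k (c \<noteq> b) u) = g False (layer k c u)" for c
      unfolding g_def deg_lift[OF simple u] by (intro sum.cong refl) blast
    then show "\<exists>b. \<forall>c. g True (layer k (c \<noteq> b) u) = g False (layer k c u)" by blast
  next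
    fix x assume "2 * k \<le> x"
    then show "g True x = g False x"
      unfolding g_def by (simp add: deg_lift_isolated[OF simple])
  qed
  then show ?thesis unfolding size_eq[symmetric] by simp
qed

lemma max_value_ge:
  assumes "feasible X" "\<And>Y. feasible Y \<Longrightarrow> Y \<subseteq> U" "finite U"
  shows "card X \<le> max_value feasible"
proof -
  have "finite {Y. feasible Y}" by (rule finite_subset[of _ "Pow U"]) (use assms in auto)
  then show ?thesis unfolding max_value_def using assms(1) by (intro Max_ge) auto
qed

lemma min_value_le:
  assumes "feasible X" "\<And>Y. feasible Y \<Longrightarrow> Y \<subseteq> U" "finite U"
  shows "min_value feasible \<le> card X"
proof -
  have "finite {Y. feasible Y}" by (rule finite_subset[of _ "Pow U"]) (use assms in auto)
  then show ?thesis unfolding min_value_def using assms(1) by (intro Min_le) auto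
qed

section \<open>Optima of the lifts\<close>

context
  fixes k n :: nat and E :: "nat set set"
  assumes simple: "simple_graph k E" and n: "2 * k \<le> n"
begin

lemma independent_set_lift_flip: "independent_set n (lift_edges k True E) ({..<k} \<union> {2 * k..<n})"
  unfolding independent_set_def
proof (intro conjI ballI)
  fix e assume "e \<in> lift_edges k True E"
  then obtain c u v where e: "e = {layer k c u, layer k (\<not> c) v}" "{u, v} \<in> E"
    by (auto simp: lift_edges_def)
  then have "u < k" "v < k" using simple_graph_edge[OF simple] by auto
  then show "\<not> e \<subseteq> {..<k} \<union> {2 * k..<n}" unfolding e(1) by (cases c) (auto simp: layer_def)
qed (use n in auto)

lemma vertex_cover_lift_flip: "vertex_cover n (lift_edges k True E) {k..<2 * k}"
  unfolding vertex_cover_def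
proof (intro conjI ballI)
  fix e assume "e \<in> lift_edges k True E"
  then obtain c u v where e: "e = {layer k c u, layer k (\<not> c) v}" "{u, v} \<in> E"
    by (auto simp: lift_edges_def)
  then have "u < k" "v < k" using simple_graph_edge[OF simple] by auto
  then show "e \<inter> {k..<2 * k} \<noteq> {}" unfolding e(1) by (cases c) (auto simp: layer_def)
qed (use n in auto)

lemma is_cut_lift_flip: "is_cut n (lift_edges k True E) (lift_edges k True E)"
proof -
  have "e \<inter> {..<k} \<noteq> {} \<and> e \<inter> {k..<n} \<noteq> {}" if "e \<in> lift_edges k True E" for e
  proof -
    from that obtain c u v where e: "e = {layer k c u, layer k (\<not> c) v}" "{u, v} \<in> E"
      by (auto simp: lift_edges_def)
    then have "u < k" "v < k" using simple_graph_edge[OF simple] by auto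
    then show ?thesis unfolding e(1) using n by (cases c) (auto simp: layer_def)
  qed
  then have "lift_edges k True E = {e \<in> lift_edges k True E. e \<inter> {..<k} \<noteq> {} \<and> e \<inter> {k..<n} \<noteq> {}}"
    by blast
  moreover have "{..<k} \<union> {k..<n} = {..<n}" "{..<k} \<inter> {k..<n} = {}" using n by auto
  ultimately show ?thesis unfolding is_cut_def by blast
qed

lemma dominating_set_lift_flip:
  assumes D: "D\<^sub>0 \<subseteq> {..<k}" "D\<^sub>1 \<subseteq> {..<k}"
    and dom: "\<forall>v<k. v \<in> D\<^sub>0 \<or> (\<exists>u\<in>D\<^sub>1. {u, v} \<in> E)" "\<forall>v<k. v \<in> D\<^sub>1 \<or> (\<exists>u\<in>D\<^sub>0. {u, v} \<in> E)"
  shows "dominating_set n (lift_edges k True E) (layer k False ` D\<^sub>0 \<union> layer k True ` D\<^sub>1 \<union> {2 * k..<n})"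
  unfolding dominating_set_def
proof (intro conjI allI impI)
  show "layer k False ` D\<^sub>0 \<union> layer k True ` D\<^sub>1 \<union> {2 * k..<n} \<subseteq> {..<n}"
    using D n by (auto simp: layer_def)
  fix x assume "x < n"
  let ?D = "layer k False ` D\<^sub>0 \<union> layer k True ` D\<^sub>1 \<union> {2 * k..<n}"
  have lift: "{layer k c u, layer k (\<not> c) v} \<in> lift_edges k True E" if "{u, v} \<in> E" for u v c
    using that by (auto simp: lift_edges_def)
  show "x \<in> ?D \<or> (\<exists>u\<in>?D. {u, x} \<in> lift_edges k True E)"
  proof (cases "x < 2 * k")
    case True
    then obtain c v where v: "v < k" "x = layer k c v" by (rule layer_cases)
    show ?thesis
    proof (cases c)
      case True
      consider "v \<in> D\<^sub>1" | u where "u \<in> D\<^sub>0" "{u, v} \<in> E" using dom(2) v(1) by blast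
      then show ?thesis
      proof cases
        case (2 u)
        have "{layer k False u, x} \<in> lift_edges k True E" using lift[OF 2(2), of False] v(2) True by simp
        then show ?thesis using 2(1) by blast
      qed (use v(2) True in simp)
    next
      case False
      consider "v \<in> D\<^sub>0" | u where "u \<in> D\<^sub>1" "{u, v} \<in> E" using dom(1) v(1) by blast
      then show ?thesis
      proof cases
        case (2 u)
        have "{layer k True u, x} \<in> lift_edges k True E" using lift[OF 2(2), of True] v(2) False by simp
        then show ?thesis using 2(1) by blast
      qed (use v(2) False in simp)
    qed
  next
    case False
    then show ?thesis using \<open>x < n\<close> by auto
  qed
qed

lemma lift_False_image: "lift_edges k False E = (\<Union>c. (`) (layer k c) ` E)"
proof (intro set_eqI iffI)
  fix e assume "e \<in> lift_edges k False E"
  then obtain c u v where "e = layer k c ` {u, v}" "{u, v} \<in> E" by (auto simp: lift_edges_def)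
  then show "e \<in> (\<Union>c. (`) (layer k c) ` E)" by blast
next
  fix e assume "e \<in> (\<Union>c. (`) (layer k c) ` E)"
  then obtain c e' where e: "e' \<in> E" "e = layer k c ` e'" by blast
  then obtain u v where "e' = {u, v}" using simple by (auto simp: simple_graph_def card_2_iff)
  then have "e = {layer k c u, layer k (c \<noteq> False) v}" "{u, v} \<in> E" using e by auto
  then show "e \<in> lift_edges k False E" unfolding lift_edges_def by blast
qed

lemma lift_False_edge: "e \<in> E \<Longrightarrow> layer k c ` e \<in> lift_edges k False E"
  unfolding lift_False_image by blast

lemma independent_set_lift_bound:
  assumes "independent_set n (lift_edges k False E) I" "\<And>J. independent_set k E J \<Longrightarrow> card J \<le> \<alpha>"
  shows "card I \<le> 2 * \<alpha> + (n - 2 * k)"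
proof -
  have I: "I \<subseteq> {..<n}" "\<And>e. e \<in> lift_edges k False E \<Longrightarrow> \<not> e \<subseteq> I"
    using assms(1) by (auto simp: independent_set_def)
  have "card {u. u < k \<and> layer k c u \<in> I} \<le> \<alpha>" for c
  proof (rule assms(2), unfold independent_set_def, intro conjI ballI)
    fix e assume "e \<in> E"
    from I(2)[OF lift_False_edge[OF this, of c]] show "\<not> e \<subseteq> {u. u < k \<and> layer k c u \<in> I}" by auto
  qed auto
  from add_mono[OF this[of False] this[of True]]
  have "card {u. u < k \<and> layer k False u \<in> I} + card {u. u < k \<and> layer k True u \<in> I} \<le> 2 * \<alpha>" by simp
  moreover have "card (I \<inter> {2 * k..<n}) \<le> n - 2 * k"
    using card_mono[of "{2 * k..<n}" "I \<inter> {2 * k..<n}"] by simp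
  ultimately show ?thesis unfolding card_layers[OF n I(1)] by linarith
qed

text \<open>Complements of vertex covers are independent, which reduces this to the previous
  bound.\<close>

lemma vertex_cover_lift_bound:
  assumes "vertex_cover n (lift_edges k False E) C" "\<And>J. independent_set k E J \<Longrightarrow> card J \<le> \<alpha>"
  shows "2 * k \<le> card C + 2 * \<alpha>"
proof -
  have C: "C \<subseteq> {..<n}" "\<And>e. e \<in> lift_edges k False E \<Longrightarrow> e \<inter> C \<noteq> {}"
    using assms(1) by (auto simp: vertex_cover_def)
  have "independent_set n (lift_edges k False E) ({..<n} - C)"
    unfolding independent_set_def using C(2) by blast
  from independent_set_lift_bound[OF this assms(2)] have "card ({..<n} - C) \<le> 2 * \<alpha> + (n - 2 * k)" by simp
  moreover have "card ({..<n} - C) = n - card C" using C(1) finite_subset by (subst card_Diff_subset) auto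
  ultimately show ?thesis using n by linarith
qed

lemma cut_lift_bound:
  assumes "is_cut n (lift_edges k False E) F" "\<And>F. is_cut k E F \<Longrightarrow> card F \<le> \<beta>"
  shows "card F \<le> 2 * \<beta>"
proof -
  obtain S T where ST: "S \<union> T = {..<n}" "S \<inter> T = {}"
    "F = {e \<in> lift_edges k False E. e \<inter> S \<noteq> {} \<and> e \<inter> T \<noteq> {}}"
    using assms(1) by (auto simp: is_cut_def)
  define G where "G c = {e \<in> E. layer k c ` e \<in> F}" for c
  have G: "card (G c) \<le> \<beta>" for c
  proof (rule assms(2))
    have "G c = {e \<in> E. e \<inter> {u. u < k \<and> layer k c u \<in> S} \<noteq> {} \<and> e \<inter> {u. u < k \<and> layer k c u \<in> T} \<noteq> {}}"
    proof -
      have "e \<subseteq> {..<k}" if "e \<in> E" for e using simple that by (auto simp: simple_graph_def)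
      then show ?thesis unfolding G_def ST(3) using lift_False_edge by blast
    qed
    moreover have "{u. u < k \<and> layer k c u \<in> S} \<union> {u. u < k \<and> layer k c u \<in> T} = {..<k}"
    proof -
      have "layer k c u \<in> S \<union> T" if "u < k" for u
        unfolding ST(1) using layer_less[OF that, of c] n by simp
      then show ?thesis by auto
    qed
    moreover have "{u. u < k \<and> layer k c u \<in> S} \<inter> {u. u < k \<and> layer k c u \<in> T} = {}"
      using ST(2) by auto
    ultimately show "is_cut k E (G c)" unfolding is_cut_def by blast
  qed
  have finG: "finite (G c)" for c using finite_edges[OF simple] by (simp add: G_def)
  have "F \<subseteq> (`) (layer k False) ` G False \<union> (`) (layer k True) ` G True"
  proof
    fix e assume e: "e \<in> F"
    then obtain c e' where "e' \<in> E" "e = layer k c ` e'" unfolding ST(3) lift_False_image by blast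
    with e show "e \<in> (`) (layer k False) ` G False \<union> (`) (layer k True) ` G True"
      by (cases c) (auto simp: G_def)
  qed
  then have "card F \<le> card ((`) (layer k False) ` G False \<union> (`) (layer k True) ` G True)"
    using finG by (intro card_mono) auto
  also have "\<dots> \<le> card (G False) + card (G True)"
    by (intro order.trans[OF card_Un_le] add_mono card_image_le finG)
  also have "\<dots> \<le> 2 * \<beta>" using add_mono[OF G[of False] G[of True]] by simp
  finally show ?thesis .
qed

lemma dominating_set_lift_bound:
  assumes "dominating_set n (lift_edges k False E) D" "\<And>D. dominating_set k E D \<Longrightarrow> \<gamma> \<le> card D"
  shows "2 * \<gamma> + (n - 2 * k) \<le> card D"
proof -
  have D: "D \<subseteq> {..<n}" "\<And>v. v < n \<Longrightarrow> v \<in> D \<or> (\<exists>u\<in>D. {u, v} \<in> lift_edges k False E)"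
    using assms(1) by (auto simp: dominating_set_def)
  have "\<gamma> \<le> card {u. u < k \<and> layer k c u \<in> D}" for c
  proof (rule assms(2), unfold dominating_set_def, intro conjI allI impI)
    fix v assume v: "v < k"
    have "layer k c v < n" using layer_less[OF v, of c] n by linarith
    from D(2)[OF this] show "v \<in> {u. u < k \<and> layer k c u \<in> D} \<or> (\<exists>u\<in>{u. u < k \<and> layer k c u \<in> D}. {u, v} \<in> E)"
    proof
      assume "\<exists>x\<in>D. {x, layer k c v} \<in> lift_edges k False E"
      then obtain x where x: "x \<in> D" "{x, layer k c v} \<in> lift_edges k False E" by blast
      from lift_edges_less(1)[OF simple x(2)] obtain d u where u: "u < k" "x = layer k d u"
        by (rule layer_cases)
      with x(2) lift_edges_iff[OF simple u(1) v, of d c False] have "c = d" "{u, v} \<in> E" by auto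
      then show ?thesis using u x(1) by blast
    qed (use v in simp)
  qed auto
  from add_mono[OF this[of False] this[of True]]
  have "2 * \<gamma> \<le> card {u. u < k \<and> layer k False u \<in> D} + card {u. u < k \<and> layer k True u \<in> D}" by simp
  \<comment> \<open>Padding vertices have no neighbours and must dominate themselves.\<close>
  moreover have "card (D \<inter> {2 * k..<n}) = n - 2 * k"
  proof -
    have "x \<in> D" if "2 * k \<le> x" "x < n" for x
      using D(2)[OF that(2)] lift_edges_less(2)[OF simple] that(1) by fastforce
    then have "D \<inter> {2 * k..<n} = {2 * k..<n}" by auto
    then show ?thesis by simp
  qed
  ultimately show ?thesis unfolding card_layers[OF n D(1)] by linarith
qed

text \<open>Counting by degrees treats both lifts alike, since lifting preserves degrees.\<close>

lemma card_lift_edges: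
  assumes "port_numbering k E p"
  shows "card (lift_edges k b E) = 2 * card E"
proof -
  have "2 * card (lift_edges k b E) = (\<Sum>x<n. deg (lift_edges k b E) x)"
    by (rule handshake[OF simple_lift[OF simple n] port_numbering_lift[OF simple assms n], symmetric])
  also have "\<dots> = (\<Sum>u<k. deg E u + deg E u)"
    unfolding sum_layers[OF n] by (simp add: deg_lift[OF simple] deg_lift_isolated[OF simple])
  also have "\<dots> = 2 * (2 * card E)"
    using handshake[OF simple assms] by (simp add: sum.distrib)
  finally show ?thesis by simp
qed

end

section \<open>The hard instance for all four problems\<close>

lemma ex_port_numbering:
  assumes "simple_graph n E"
  shows "\<exists>p. port_numbering n E p"
proof -
  have "\<exists>q. bij_betw q {..<deg E v} (nbrs E v)" for v
  proof -
    have "nbrs E v \<subseteq> {..<n}" using simple_graph_edge[OF assms] by (auto simp: nbrs_def)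
    then have "finite (nbrs E v)" using finite_subset by blast
    from ex_bij_betw_nat_finite[OF this] show ?thesis by (auto simp: deg_def atLeast0LessThan)
  qed
  then show ?thesis unfolding port_numbering_def by metis
qed

text \<open>The bounds for the two lifts lie at least n/2 apart, on a scale of at most N; for cuts
  the figures are n and 2 N. The condition on \<epsilon> N therefore leaves no room for an
  approximation with equal expectations on both. Vertices from \<open>2 * base_size\<close> on are
  padding.\<close>

locale hard_instance = subdivision +
  fixes K N :: nat and \<epsilon> :: real
  assumes odd_walks: "\<forall>x es. set es \<subseteq> {..<m} \<and> walk f x es x \<and> odd (length es) \<longrightarrow> 2 * K < length es"
    and N_ge: "2 * base_size \<le> N"
    and eps: "0 < \<epsilon>" "\<epsilon> < 1" "2 * (\<epsilon> * real N) < real n"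
begin

definition p where "p = (SOME p. port_numbering base_size edges p)"

lemma ports: "port_numbering base_size edges p"
  unfolding p_def by (rule someI_ex[OF ex_port_numbering[OF simple_edges]])

lemma lift_instance:
  "simple_graph N (lift_edges base_size b edges) \<and>
    port_numbering N (lift_edges base_size b edges) (lift_ports base_size b p)"
  using simple_lift[OF simple_edges N_ge] port_numbering_lift[OF simple_edges ports N_ge] by blast

text \<open>\<Phi> may start at q + 1, so one of the K path lengths in the budget is spent before
  the first round.\<close>

lemma layering_rounds:
  assumes "r + Suc q \<le> Suc q * K"
  shows "\<forall>x<base_size. \<exists>(\<Phi> :: nat \<Rightarrow> nat) s. \<Phi> x + r \<le> Suc q * K \<and>
    (\<forall>u u'. {u, u'} \<in> edges \<and> \<Phi> u < Suc q * K \<longrightarrow> (s u' \<longleftrightarrow> \<not> s u) \<and> \<Phi> u' \<le> Suc (\<Phi> u))"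
proof (intro allI impI)
  fix x assume x: "x < base_size"
  obtain \<Phi> s where \<Phi>: "\<Phi> x \<le> Suc q"
    "\<And>u u'. {u, u'} \<in> edges \<Longrightarrow> \<Phi> u < Suc q * K \<Longrightarrow> (s u' \<longleftrightarrow> \<not> s u) \<and> \<Phi> u' \<le> Suc (\<Phi> u)"
    using layering[OF odd_walks x] by blast
  show "\<exists>(\<Phi> :: nat \<Rightarrow> nat) s. \<Phi> x + r \<le> Suc q * K \<and>
    (\<forall>u u'. {u, u'} \<in> edges \<and> \<Phi> u < Suc q * K \<longrightarrow> (s u' \<longleftrightarrow> \<not> s u) \<and> \<Phi> u' \<le> Suc (\<Phi> u))"
    by (rule exI[of _ \<Phi>], rule exI[of _ s]) (use \<Phi> assms in auto)
qed

lemma eps_le: "real x \<le> real N \<Longrightarrow> 2 * (\<epsilon> * real x) < real n"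
  using eps mult_left_mono[of "real x" "real N" \<epsilon>] by linarith

lemma independent_card:
  assumes "independent_set base_size edges J"
  shows "card J \<le> (base_size + n div 2 - n) div 2"
  using independent_set_bound[OF assms] by linarith

text \<open>The double cover forces the expectation up to (1 - \<epsilon>) (N - base_size), while
  the two copies keep it at most N - base_size - n/2. As both expectations are equal, n/2 \<le>
  \<epsilon> (N - base_size) would follow.\<close>

lemma no_max_independent_set:
  assumes r: "rounds A N + Suc q \<le> Suc q * K"
  shows "\<not> approx_max_independent_set \<epsilon> N A"
proof
  assume "approx_max_independent_set \<epsilon> N A"
  then have A: "random_set (random_bits N) (vertex_solution A N (lift_edges base_size b edges) (lift_ports base_size b p))"
    "w \<in> space (random_bits N) \<Longrightarrow> independent_set N (lift_edges base_size b edges)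
      (vertex_solution A N (lift_edges base_size b edges) (lift_ports base_size b p) w)"
    "expected_size (random_bits N) (vertex_solution A N (lift_edges base_size b edges) (lift_ports base_size b p))
      \<ge> (1 - \<epsilon>) * max_value (independent_set N (lift_edges base_size b edges))" for b w
    using lift_instance[of b] unfolding approx_max_independent_set_def by blast+
  let ?X = "\<lambda>b. expected_size (random_bits N) (vertex_solution A N (lift_edges base_size b edges) (lift_ports base_size b p))"
  have "card ({..<base_size} \<union> {2 * base_size..<N}) \<le> max_value (independent_set N (lift_edges base_size True edges))"
    by (rule max_value_ge[where feasible = "independent_set N _" and U = "{..<N}",
        OF independent_set_lift_flip[OF simple_edges N_ge]])
      (auto simp: independent_set_def)
  moreover have "card ({..<base_size} \<union> {2 * base_size..<N}) = N - base_size"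
    using N_ge by (subst card_Un_disjoint) auto
  ultimately have "(1 - \<epsilon>) * (real N - real base_size)
      \<le> (1 - \<epsilon>) * max_value (independent_set N (lift_edges base_size True edges))"
    using N_ge eps by (intro mult_left_mono) auto
  also have "\<dots> \<le> ?X True" by (rule A(3))
  also have "?X True = ?X False"
    by (rule expected_vertex_solution_lift[OF simple_edges ports N_ge layering_rounds[OF r] A(1)])
  also have "?X False \<le> real N - real base_size - real n / 2"
  proof (rule expected_size_bounds(1)[OF prob_space_random_bits A(1), of "{..<N}"])
    fix w assume w: "w \<in> space (random_bits N)"
    let ?I = "vertex_solution A N (lift_edges base_size False edges) (lift_ports base_size False p) w"
    have "card ?I \<le> 2 * ((base_size + n div 2 - n) div 2) + (N - 2 * base_size)"
      by (rule independent_set_lift_bound[OF simple_edges N_ge A(2)[OF w] independent_card])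
    moreover have "n \<le> base_size" by (simp add: base_size_def)
    ultimately have "2 * card ?I + 2 * base_size + n \<le> 2 * N" using N_ge by linarith
    then have "real (2 * card ?I + 2 * base_size + n) \<le> real (2 * N)" by (simp only: of_nat_le_iff)
    then show "real (card ?I) \<le> real N - real base_size - real n / 2" by simp
  qed (auto simp: vertex_solution_def)
  finally have "real n \<le> 2 * (\<epsilon> * (real N - real base_size))" by (simp add: algebra_simps)
  also have "real N - real base_size = real (N - base_size)" using N_ge by simp
  finally show False using eps_le[of "N - base_size"] by simp
qed

lemma no_min_vertex_cover:
  assumes r: "rounds A N + Suc q \<le> Suc q * K"
  shows "\<not> approx_min_vertex_cover \<epsilon> N A"
proof
  assume "approx_min_vertex_cover \<epsilon> N A"
  then have A: "random_set (random_bits N) (vertex_solution A N (lift_edges base_size b edges) (lift_ports base_size b p))"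
    "w \<in> space (random_bits N) \<Longrightarrow> vertex_cover N (lift_edges base_size b edges)
      (vertex_solution A N (lift_edges base_size b edges) (lift_ports base_size b p) w)"
    "expected_size (random_bits N) (vertex_solution A N (lift_edges base_size b edges) (lift_ports base_size b p))
      \<le> (1 + \<epsilon>) * min_value (vertex_cover N (lift_edges base_size b edges))" for b w
    using lift_instance[of b] unfolding approx_min_vertex_cover_def by blast+
  let ?X = "\<lambda>b. expected_size (random_bits N) (vertex_solution A N (lift_edges base_size b edges) (lift_ports base_size b p))"
  have "min_value (vertex_cover N (lift_edges base_size True edges)) \<le> card {base_size..<2 * base_size}"
    by (rule min_value_le[where feasible = "vertex_cover N _" and U = "{..<N}",
        OF vertex_cover_lift_flip[OF simple_edges N_ge]])
      (auto simp: vertex_cover_def)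
  then have le: "(1 + \<epsilon>) * min_value (vertex_cover N (lift_edges base_size True edges)) \<le> (1 + \<epsilon>) * real base_size"
    using eps by (intro mult_left_mono) auto
  have "real base_size + real n / 2 \<le> ?X False"
  proof (rule expected_size_bounds(2)[OF prob_space_random_bits A(1), of "{..<N}"])
    fix w assume w: "w \<in> space (random_bits N)"
    let ?C = "vertex_solution A N (lift_edges base_size False edges) (lift_ports base_size False p) w"
    have "2 * base_size \<le> card ?C + 2 * ((base_size + n div 2 - n) div 2)"
      by (rule vertex_cover_lift_bound[OF simple_edges N_ge A(2)[OF w] independent_card])
    moreover have "n \<le> base_size" by (simp add: base_size_def)
    ultimately have "2 * base_size + n \<le> 2 * card ?C" by linarith
    then have "real (2 * base_size + n) \<le> real (2 * card ?C)" by (simp only: of_nat_le_iff)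
    then show "real base_size + real n / 2 \<le> real (card ?C)" by simp
  qed (auto simp: vertex_solution_def)
  also have "?X False = ?X True"
    by (rule expected_vertex_solution_lift[OF simple_edges ports N_ge layering_rounds[OF r] A(1), symmetric])
  also have "?X True \<le> (1 + \<epsilon>) * min_value (vertex_cover N (lift_edges base_size True edges))" by (rule A(3))
  also note le
  finally have "real n \<le> 2 * (\<epsilon> * real base_size)" by (simp add: algebra_simps)
  then show False using eps_le[of base_size] N_ge by simp
qed

text \<open>Besides \<open>2 * M\<close> path vertices and the padding, the two copies need 7 n / 2
  vertices and the double cover only 3 n; the gap is n/2.\<close>

lemma no_min_dominating_set:
  assumes r: "rounds A N + Suc q \<le> Suc q * K"
  shows "\<not> approx_min_dominating_set \<epsilon> N A"
proof
  assume "approx_min_dominating_set \<epsilon> N A"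
  then have A: "random_set (random_bits N) (vertex_solution A N (lift_edges base_size b edges) (lift_ports base_size b p))"
    "w \<in> space (random_bits N) \<Longrightarrow> dominating_set N (lift_edges base_size b edges)
      (vertex_solution A N (lift_edges base_size b edges) (lift_ports base_size b p) w)"
    "expected_size (random_bits N) (vertex_solution A N (lift_edges base_size b edges) (lift_ports base_size b p))
      \<le> (1 + \<epsilon>) * min_value (dominating_set N (lift_edges base_size b edges))" for b w
    using lift_instance[of b] unfolding approx_min_dominating_set_def by blast+
  let ?X = "\<lambda>b. expected_size (random_bits N) (vertex_solution A N (lift_edges base_size b edges) (lift_ports base_size b p))"
  define M where "M = m * (2 * j + 1)"
  define B where "B = 3 * n + 2 * M + (N - 2 * base_size)"
  obtain D\<^sub>0 D\<^sub>1 where D: "D\<^sub>0 \<subseteq> {..<base_size}" "D\<^sub>1 \<subseteq> {..<base_size}"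
    "\<forall>v<base_size. v \<in> D\<^sub>0 \<or> (\<exists>u\<in>D\<^sub>1. {u, v} \<in> edges)"
    "\<forall>v<base_size. v \<in> D\<^sub>1 \<or> (\<exists>u\<in>D\<^sub>0. {u, v} \<in> edges)"
    "card D\<^sub>0 + card D\<^sub>1 = 3 * n + 2 * (m * (2 * j + 1))"
    using dominating_pair by blast
  have finD: "finite D\<^sub>0" "finite D\<^sub>1" using D(1,2) finite_subset by blast+
  let ?D = "layer base_size False ` D\<^sub>0 \<union> layer base_size True ` D\<^sub>1 \<union> {2 * base_size..<N}"
  have "min_value (dominating_set N (lift_edges base_size True edges)) \<le> card ?D"
    by (rule min_value_le[where feasible = "dominating_set N _" and U = "{..<N}",
        OF dominating_set_lift_flip[OF simple_edges N_ge D(1-4)]])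
      (auto simp: dominating_set_def)
  also have "card ?D \<le> card D\<^sub>0 + card D\<^sub>1 + (N - 2 * base_size)"
  proof -
    have "card ?D \<le> card (layer base_size False ` D\<^sub>0 \<union> layer base_size True ` D\<^sub>1) + card {2 * base_size..<N}"
      by (rule card_Un_le)
    also have "\<dots> \<le> (card D\<^sub>0 + card D\<^sub>1) + (N - 2 * base_size)"
      by (intro add_mono order.trans[OF card_Un_le] card_image_le finD) simp
    finally show ?thesis .
  qed
  finally have "min_value (dominating_set N (lift_edges base_size True edges)) \<le> B"
    using D(5) by (simp add: B_def M_def)
  then have le: "(1 + \<epsilon>) * min_value (dominating_set N (lift_edges base_size True edges)) \<le> (1 + \<epsilon>) * real B"
    using eps by (intro mult_left_mono) auto
  have "real B + real n / 2 \<le> ?X False"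
  proof (rule expected_size_bounds(2)[OF prob_space_random_bits A(1), of "{..<N}"])
    fix w assume w: "w \<in> space (random_bits N)"
    let ?C = "vertex_solution A N (lift_edges base_size False edges) (lift_ports base_size False p) w"
    \<comment> \<open>This is 7 n / 4 + M rounded up, as the bound for a single copy has to be a
      natural number.\<close>
    define \<gamma> where "\<gamma> = (7 * n + 4 * M + 3) div 4"
    have "\<gamma> \<le> card D" if "dominating_set base_size edges D" for D
      using dominating_set_bound[OF that] unfolding M_def[symmetric] \<gamma>_def by linarith
    then have "2 * \<gamma> + (N - 2 * base_size) \<le> card ?C"
      by (rule dominating_set_lift_bound[OF simple_edges N_ge A(2)[OF w]])
    moreover have "7 * n + 4 * M \<le> 4 * \<gamma>" unfolding \<gamma>_def by linarith
    ultimately have "2 * B + n \<le> 2 * card ?C" unfolding B_def add_mult_distrib2 by linarith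
    then have "real (2 * B + n) \<le> real (2 * card ?C)" by (simp only: of_nat_le_iff)
    then show "real B + real n / 2 \<le> real (card ?C)" by simp
  qed (auto simp: vertex_solution_def)
  also have "?X False = ?X True"
    by (rule expected_vertex_solution_lift[OF simple_edges ports N_ge layering_rounds[OF r] A(1), symmetric])
  also have "?X True \<le> (1 + \<epsilon>) * min_value (dominating_set N (lift_edges base_size True edges))" by (rule A(3))
  also note le
  finally have "real n \<le> 2 * (\<epsilon> * real B)" by (simp add: algebra_simps)
  moreover have "B \<le> N"
  proof -
    have "M \<le> m * q" unfolding M_def q_def by (intro mult_left_mono) auto
    then have "3 * n + 2 * M \<le> 2 * base_size" unfolding base_size_def add_mult_distrib2 by linarith
    then show ?thesis using N_ge unfolding B_def by linarith
  qed
  ultimately show False using eps_le[of B] by simp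
qed

lemma card_edges_le: "card edges \<le> N"
proof -
  have "edges = (\<lambda>(e, i). {pos e i, pos e (Suc i)}) ` ({..<m} \<times> {..q})
    \<union> (\<lambda>v. {v, n + v}) ` {..<n} \<union> (\<lambda>v. {n + v, 2 * n + v}) ` {..<n}"
    unfolding edges_def by auto
  then have "card edges \<le> card ({..<m} \<times> {..q}) + card {..<n} + card {..<n}"
    by (simp only:) (intro order.trans[OF card_Un_le] add_mono card_image_le; simp)
  also have "\<dots> = m * Suc q + 2 * n" by (simp add: card_cartesian_product)
  also have "\<dots> \<le> 2 * base_size"
  proof -
    have "m \<le> m * q" using q_pos by simp
    then show ?thesis unfolding base_size_def mult_Suc_right add_mult_distrib2 by linarith
  qed
  finally show ?thesis using N_ge by simp
qed

lemma no_max_cut: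
  assumes r: "rounds A N + Suc q \<le> Suc q * K"
  shows "\<not> approx_max_cut \<epsilon> N A"
proof
  assume "approx_max_cut \<epsilon> N A"
  then have A: "random_set (random_bits N) (edge_solution A N (lift_edges base_size b edges) (lift_ports base_size b p))"
    "w \<in> space (random_bits N) \<Longrightarrow> edge_agreement A N (lift_edges base_size b edges) (lift_ports base_size b p) w"
    "w \<in> space (random_bits N) \<Longrightarrow> is_cut N (lift_edges base_size b edges)
      (edge_solution A N (lift_edges base_size b edges) (lift_ports base_size b p) w)"
    "expected_size (random_bits N) (edge_solution A N (lift_edges base_size b edges) (lift_ports base_size b p))
      \<ge> (1 - \<epsilon>) * max_value (is_cut N (lift_edges base_size b edges))" for b w
    using lift_instance[of b] unfolding approx_max_cut_def by blast+
  let ?X = "\<lambda>b. expected_size (random_bits N) (edge_solution A N (lift_edges base_size b edges) (lift_ports base_size b p))"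
  have fin: "finite (lift_edges base_size b edges)" for b using lift_instance[of b] finite_edges by blast
  have "card (lift_edges base_size True edges) \<le> max_value (is_cut N (lift_edges base_size True edges))"
    by (rule max_value_ge[where feasible = "is_cut N _", OF is_cut_lift_flip[OF simple_edges N_ge] _ fin]) (auto simp: is_cut_def)
  then have "(1 - \<epsilon>) * (2 * real (card edges)) \<le> (1 - \<epsilon>) * max_value (is_cut N (lift_edges base_size True edges))"
    unfolding card_lift_edges[OF simple_edges N_ge ports] using eps by (intro mult_left_mono) auto
  also have "\<dots> \<le> ?X True" by (rule A(4))
  also have "?X True = ?X False"
    by (rule expected_edge_solution_lift[OF simple_edges ports N_ge layering_rounds[OF r] A(1,2)])
  also have "?X False \<le> 2 * real (card edges) - real n"
  proof (rule expected_size_bounds(1)[OF prob_space_random_bits A(1) fin[of False]])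
    fix w assume w: "w \<in> space (random_bits N)"
    let ?F = "edge_solution A N (lift_edges base_size False edges) (lift_ports base_size False p) w"
    show "?F \<subseteq> lift_edges base_size False edges"
      using edge_solution_subset lift_instance[of False] by blast
    have "card F \<le> (2 * card edges - n) div 2" if "is_cut base_size edges F" for F
      using cut_bound[OF that] by linarith
    then have "card ?F \<le> 2 * ((2 * card edges - n) div 2)"
      by (rule cut_lift_bound[OF simple_edges N_ge A(3)[OF w]])
    \<comment> \<open>Guards the truncated subtraction; the bound for the empty cut already shows
      it.\<close>
    moreover have "n \<le> 2 * card edges"
    proof -
      have "is_cut base_size edges {}"
        unfolding is_cut_def by (intro exI[of _ "{..<base_size}"] exI[of _ "{}"]) simp
      from cut_bound[OF this] show ?thesis by simp
    qed
    ultimately have "card ?F + n \<le> 2 * card edges" by linarith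
    then have "real (card ?F + n) \<le> real (2 * card edges)" by (simp only: of_nat_le_iff)
    then show "real (card ?F) \<le> 2 * real (card edges) - real n" by simp
  qed
  finally have "real n \<le> 2 * (\<epsilon> * real (card edges))" by (simp add: algebra_simps)
  then show False using eps_le[of "card edges"] card_edges_le by simp
qed

end

section \<open>Choice of parameters\<close>

text \<open>200^(2 K) = 40000^K is at most exp (12 K). With K about ln N / 24 this is of order sqrt
  N, which is eventually below N / a by any constant factor.\<close>

lemma ex_girth_parameter:
  fixes a :: nat
  assumes "a > 0"
  shows "\<exists>n\<^sub>0. \<forall>N\<ge>n\<^sub>0. \<exists>K. 8 * 200 ^ Suc (2 * K) \<le> N div a \<and> ln (real N) / 24 \<le> real K - 1"
proof -
  have "\<forall>\<^sub>F x :: real in at_top. 1600 * exp 24 * sqrt x \<le> x / real a - 1"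
    using assms by real_asymp
  then have "\<forall>\<^sub>F N in sequentially. 1600 * exp 24 * sqrt (real N) \<le> real N / real a - 1"
    by (rule eventually_compose_filterlim[OF _ filterlim_real_sequentially])
  then obtain n\<^sub>0 where n0: "\<And>N. N \<ge> n\<^sub>0 \<Longrightarrow> 1600 * exp 24 * sqrt (real N) \<le> real N / real a - 1"
    by (auto simp: eventually_sequentially)
  show ?thesis
  proof (rule exI[of _ "max n\<^sub>0 1"], intro allI impI)
    fix N assume N: "max n\<^sub>0 1 \<le> N"
    define x where "x = ln (real N) / 24"
    have "x \<ge> 0" using N by (simp add: x_def)
    \<comment> \<open>Rounding up and adding 1 makes K - 1 at least ln N / 24 and K at most ln N /
      24 + 2. The excess 2 is the source of the factor exp 24, and 1600 is 8 * 200.\<close>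
    define K where "K = nat \<lceil>x\<rceil> + 1"
    have K: "x + 1 \<le> real K" "real K \<le> x + 2" using \<open>x \<ge> 0\<close> unfolding K_def by linarith+
    have "(40000 :: real) \<le> exp 12"
    proof -
      have "(2.5 :: real) \<le> exp 1" using exp_lower_Taylor_quadratic[of 1] by simp
      then have "(2.5 :: real) ^ 12 \<le> exp 1 ^ 12" by (intro power_mono) auto
      also have "exp 1 ^ 12 = (exp 12 :: real)" by (simp flip: exp_of_nat_mult)
      finally show ?thesis by (simp add: power_divide)
    qed
    then have "40000 ^ K \<le> (exp 12 :: real) ^ K" by (intro power_mono) auto
    also have "\<dots> = exp (real K * 12)" by (simp add: exp_of_nat_mult)
    also have "\<dots> \<le> exp (ln (real N) / 2 + 24)" using K(2) by (simp add: x_def)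
    also have "\<dots> = exp 24 * sqrt (real N)"
      using N by (simp add: exp_add ln_sqrt[symmetric])
    finally have "1600 * 40000 ^ K \<le> real N / real a - 1"
      using n0[of N] N by simp
    also have "\<dots> \<le> real (N div a)"
    proof -
      have "N mod a < a" using assms by simp
      then have "N \<le> N div a * a + a" using div_mult_mod_eq[of N a] by linarith
      then have "real N \<le> real (N div a * a + a)" by (simp only: of_nat_le_iff)
      then have "real N \<le> (real (N div a) + 1) * real a" by (simp add: algebra_simps)
      then have "real N / real a \<le> real (N div a) + 1" using assms by (simp add: pos_divide_le_eq)
      then show ?thesis by simp
    qed
    finally have "real (1600 * 40000 ^ K) \<le> real (N div a)" by simp
    then have "1600 * 40000 ^ K \<le> N div a" by (simp only: of_nat_le_iff)
    moreover have "8 * 200 ^ Suc (2 * K) = 1600 * (40000 :: nat) ^ K"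
      by (simp add: power_mult)
    ultimately show "\<exists>K. 8 * 200 ^ Suc (2 * K) \<le> N div a \<and> ln (real N) / 24 \<le> real K - 1"
      using K(1) by (intro exI[of _ K]) (auto simp: x_def K_def)
  qed
qed

lemma hard_parameters:
  fixes \<epsilon> :: real
  assumes "0 < \<epsilon>" "\<epsilon> \<le> 1 / 10000"
  shows "\<exists>n\<^sub>0. \<forall>N\<ge>n\<^sub>0. \<exists>j n K. 8 * 200 ^ Suc (2 * K) \<le> n \<and> 2 * (3 * n + 100 * n * (6 * j + 4)) \<le> N
    \<and> 2 * (\<epsilon> * real N) < real n
    \<and> (\<forall>r :: nat. real r < 1 / 100000 * (ln (real N) / \<epsilon>) \<longrightarrow> r + Suc (6 * j + 4) \<le> Suc (6 * j + 4) * K)"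
proof -
  \<comment> \<open>Path lengths are of order 1/\<epsilon>, but short enough that more than 2
    \<epsilon> N of the N vertices can be original ones. The bound on \<epsilon> gives x \<ge> 1 and
    hence j \<ge> 1.\<close>
  define x where "x = 1 / (10000 * \<epsilon>)"
  have "1 \<le> x" using assms by (simp add: x_def field_simps)
  define j where "j = nat \<lfloor>x\<rfloor>"
  have j: "1 \<le> real j" "real j \<le> x" "x \<le> 2 * real j"
  proof -
    have "1 \<le> \<lfloor>x\<rfloor>" using \<open>1 \<le> x\<close> by linarith
    then have "real j = of_int \<lfloor>x\<rfloor>" "(1 :: real) \<le> of_int \<lfloor>x\<rfloor>" by (simp_all add: j_def)
    then show "1 \<le> real j" "real j \<le> x" "x \<le> 2 * real j" using floor_correct[of x] by linarith+
  qed
  have \<epsilon>j: "\<epsilon> * real j \<le> 1 / 10000" "1 / 20000 \<le> \<epsilon> * real j"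
    using j(2,3) assms(1) by (simp_all add: x_def field_simps)
  \<comment> \<open>The number of vertices in both copies per original vertex if the multigraph has
    the full 100 n edges. For j \<ge> 1 it is at most 2020 j, and 4 * 2020 < 10000 is what the
    choice of \<open>x\<close> aims at.\<close>
  define a where "a = 2 * (3 + 100 * (6 * j + 4))"
  have "a > 0" by (simp add: a_def)
  from ex_girth_parameter[OF this] obtain n\<^sub>0 where
    n0: "\<forall>N\<ge>n\<^sub>0. \<exists>K. 8 * 200 ^ Suc (2 * K) \<le> N div a \<and> ln (real N) / 24 \<le> real K - 1" by blast
  show ?thesis
  proof (rule exI[of _ "max n\<^sub>0 1"], intro allI impI)
    fix N assume N: "max n\<^sub>0 1 \<le> N"
    define n where "n = N div a"
    from n0 N obtain K where K: "8 * 200 ^ Suc (2 * K) \<le> n" "ln (real N) / 24 \<le> real K - 1"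
      unfolding n_def by auto
    have "(0 :: nat) < 8 * 200 ^ Suc (2 * K)" by simp
    then have "n \<ge> 1" using K(1) by linarith
    have 1: "2 * (3 * n + 100 * n * (6 * j + 4)) \<le> N"
    proof -
      have "2 * (3 * n + 100 * n * (6 * j + 4)) = n * a" by (simp add: a_def algebra_simps)
      also have "\<dots> \<le> N" by (simp add: n_def)
      finally show ?thesis .
    qed
    have 2: "2 * (\<epsilon> * real N) < real n"
    proof -
      have "N mod a < a" using \<open>a > 0\<close> by simp
      then have "N < n * a + a" using div_mult_mod_eq[of N a] unfolding n_def by linarith
      also have "\<dots> \<le> n * a + n * a" using \<open>n \<ge> 1\<close> by simp
      finally have "N < 2 * n * a" by simp
      then have "real N < real (2 * n * a)" by (simp only: of_nat_less_iff)
      then have "2 * (\<epsilon> * real N) < 2 * (\<epsilon> * real (2 * n * a))"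
        using assms(1) by (intro mult_strict_left_mono) simp_all
      also have "\<dots> = (4 * (\<epsilon> * real a)) * real n" by simp
      also have "\<dots> \<le> 1 * real n"
      proof (rule mult_right_mono)
        have "real a \<le> 2020 * real j" using j(1) by (simp add: a_def)
        then have "\<epsilon> * real a \<le> \<epsilon> * (2020 * real j)" using assms(1) by (intro mult_left_mono) auto
        then show "4 * (\<epsilon> * real a) \<le> 1" using \<epsilon>j(1) by linarith
      qed simp
      finally show ?thesis by simp
    qed
    have 3: "r + Suc (6 * j + 4) \<le> Suc (6 * j + 4) * K"
      if r: "real r < 1 / 100000 * (ln (real N) / \<epsilon>)" for r :: nat
    proof -
      have ln: "0 \<le> ln (real N)" using N by simp
      \<comment> \<open>The budget (q + 1) (K - 1) is at least 6 j ln N / 24 = j ln N / 4. With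
        \<epsilon> j \<ge> 1/20000 this is at least ln N / (80000 \<epsilon>), which is rounded
        down.\<close>
      have "1 / 100000 * (ln (real N) / \<epsilon>) \<le> real j * (ln (real N) / 4)"
      proof -
        have "1 / 100000 * ln (real N) \<le> (\<epsilon> * real j / 4) * ln (real N)"
          using \<epsilon>j(2) ln by (intro mult_right_mono) auto
        then show ?thesis using assms(1) by (simp add: field_simps)
      qed
      also have "\<dots> = (6 * real j) * (ln (real N) / 24)" by simp
      also have "\<dots> \<le> real (Suc (6 * j + 4)) * (real K - 1)"
        using K(2) ln by (intro mult_mono) auto
      finally have "real r + real (Suc (6 * j + 4)) \<le> real (Suc (6 * j + 4)) * real K"
        using r by (simp add: algebra_simps)
      then have "real (r + Suc (6 * j + 4)) \<le> real (Suc (6 * j + 4) * K)"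
        by (simp only: of_nat_add of_nat_mult)
      then show ?thesis by (simp only: of_nat_le_iff)
    qed
    show "\<exists>j n K. 8 * 200 ^ Suc (2 * K) \<le> n \<and> 2 * (3 * n + 100 * n * (6 * j + 4)) \<le> N
      \<and> 2 * (\<epsilon> * real N) < real n
      \<and> (\<forall>r :: nat. real r < 1 / 100000 * (ln (real N) / \<epsilon>) \<longrightarrow> r + Suc (6 * j + 4) \<le> Suc (6 * j + 4) * K)"
      using K(1) 1 2 3 by blast
  qed
qed

text \<open>One instance serves all four problems, and the threshold depends on \<epsilon> alone: it
  is fixed before the algorithms \<open>A\<close> and \<open>B\<close>.\<close>

lemma round_lower_bound:
  fixes \<epsilon> :: real
  assumes "0 < \<epsilon>" "\<epsilon> \<le> 1 / 10000"
  shows "\<exists>n\<^sub>0. \<forall>N\<ge>n\<^sub>0. \<forall>(A :: bool local_alg) (B :: (nat \<Rightarrow> bool) local_alg).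
    (real (rounds A N) < 1 / 100000 * (ln (real N) / \<epsilon>) \<longrightarrow>
      \<not> approx_max_independent_set \<epsilon> N A \<and> \<not> approx_min_vertex_cover \<epsilon> N A \<and> \<not> approx_min_dominating_set \<epsilon> N A) \<and>
    (real (rounds B N) < 1 / 100000 * (ln (real N) / \<epsilon>) \<longrightarrow> \<not> approx_max_cut \<epsilon> N B)"
proof -
  from hard_parameters[OF assms] obtain n\<^sub>0 where
    n0: "\<forall>N\<ge>n\<^sub>0. \<exists>j n K. 8 * 200 ^ Suc (2 * K) \<le> n \<and> 2 * (3 * n + 100 * n * (6 * j + 4)) \<le> N
    \<and> 2 * (\<epsilon> * real N) < real n
    \<and> (\<forall>r :: nat. real r < 1 / 100000 * (ln (real N) / \<epsilon>) \<longrightarrow> r + Suc (6 * j + 4) \<le> Suc (6 * j + 4) * K)"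
    by blast
  show ?thesis
  proof (intro exI[of _ n\<^sub>0] allI impI)
    fix N and A :: "bool local_alg" and B :: "(nat \<Rightarrow> bool) local_alg" assume "n\<^sub>0 \<le> N"
    with n0 obtain j n K where K: "8 * 200 ^ Suc (2 * K) \<le> n"
      and N: "2 * (3 * n + 100 * n * (6 * j + 4)) \<le> N" "2 * (\<epsilon> * real N) < real n"
      and r: "\<forall>r :: nat. real r < 1 / 100000 * (ln (real N) / \<epsilon>) \<longrightarrow> r + Suc (6 * j + 4) \<le> Suc (6 * j + 4) * K"
      by blast
    obtain m f where f: "m \<le> 100 * n" "\<forall>e<m. fst (f e) < n \<and> snd (f e) < n"
      "\<forall>S\<subseteq>{..<n}. 4 * card S \<le> n + 4 * card (spanned m f S)"
      "\<forall>x es. set es \<subseteq> {..<m} \<and> walk f x es x \<and> odd (length es) \<longrightarrow> 2 * K < length es"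
      using sparse_locally_bipartite_multigraph[OF K] by blast
    interpret subdivision n m j f
      by unfold_locales (use f(2,3) in blast)+
    interpret hard_instance n m j f K N \<epsilon>
    proof unfold_locales
      have "m * (6 * j + 4) \<le> 100 * n * (6 * j + 4)" using f(1) by (intro mult_right_mono) auto
      then have "base_size \<le> 3 * n + 100 * n * (6 * j + 4)" unfolding base_size_def q_def by linarith
      then have "2 * base_size \<le> 2 * (3 * n + 100 * n * (6 * j + 4))" by (rule mult_left_mono) simp
      then show "2 * base_size \<le> N" using N(1) by (rule order.trans)
    qed (use f(4) N(2) assms in auto)
    show "(real (rounds A N) < 1 / 100000 * (ln (real N) / \<epsilon>) \<longrightarrow>
        \<not> approx_max_independent_set \<epsilon> N A \<and> \<not> approx_min_vertex_cover \<epsilon> N A \<and> \<not> approx_min_dominating_set \<epsilon> N A) \<and>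
      (real (rounds B N) < 1 / 100000 * (ln (real N) / \<epsilon>) \<longrightarrow> \<not> approx_max_cut \<epsilon> N B)"
    proof (intro conjI impI)
      assume "real (rounds A N) < 1 / 100000 * (ln (real N) / \<epsilon>)"
      with r have "rounds A N + Suc q \<le> Suc q * K" unfolding q_def by blast
      then show "\<not> approx_max_independent_set \<epsilon> N A" "\<not> approx_min_vertex_cover \<epsilon> N A"
        "\<not> approx_min_dominating_set \<epsilon> N A"
        by (fact no_max_independent_set no_min_vertex_cover no_min_dominating_set)+
    next
      assume "real (rounds B N) < 1 / 100000 * (ln (real N) / \<epsilon>)"
      with r have "rounds B N + Suc q \<le> Suc q * K" unfolding q_def by blast
      then show "\<not> approx_max_cut \<epsilon> N B" by (rule no_max_cut)
    qed
  qed
qed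

theorem theorem1p8:
  "(\<exists>\<epsilon>\<^sub>0 c :: real. 0 < \<epsilon>\<^sub>0 \<and> \<epsilon>\<^sub>0 < 1 \<and> 0 < c \<and>
       (\<forall>\<epsilon>. 0 < \<epsilon> \<and> \<epsilon> \<le> \<epsilon>\<^sub>0 \<longrightarrow> (\<exists>n\<^sub>0. \<forall>n\<ge>n\<^sub>0. \<forall>A :: bool local_alg.
          approx_max_independent_set \<epsilon> n A \<longrightarrow> real (rounds A n) \<ge> c * (ln (real n) / \<epsilon>)))) \<and>
    (\<exists>\<epsilon>\<^sub>0 c :: real. 0 < \<epsilon>\<^sub>0 \<and> \<epsilon>\<^sub>0 < 1 \<and> 0 < c \<and>
       (\<forall>\<epsilon>. 0 < \<epsilon> \<and> \<epsilon> \<le> \<epsilon>\<^sub>0 \<longrightarrow> (\<exists>n\<^sub>0. \<forall>n\<ge>n\<^sub>0. \<forall>A :: (nat \<Rightarrow> bool) local_alg.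
          approx_max_cut \<epsilon> n A \<longrightarrow> real (rounds A n) \<ge> c * (ln (real n) / \<epsilon>)))) \<and>
    (\<exists>\<epsilon>\<^sub>0 c :: real. 0 < \<epsilon>\<^sub>0 \<and> \<epsilon>\<^sub>0 < 1 \<and> 0 < c \<and>
       (\<forall>\<epsilon>. 0 < \<epsilon> \<and> \<epsilon> \<le> \<epsilon>\<^sub>0 \<longrightarrow> (\<exists>n\<^sub>0. \<forall>n\<ge>n\<^sub>0. \<forall>A :: bool local_alg.
          approx_min_vertex_cover \<epsilon> n A \<longrightarrow> real (rounds A n) \<ge> c * (ln (real n) / \<epsilon>)))) \<and>
    (\<exists>\<epsilon>\<^sub>0 c :: real. 0 < \<epsilon>\<^sub>0 \<and> \<epsilon>\<^sub>0 < 1 \<and> 0 < c \<and>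
       (\<forall>\<epsilon>. 0 < \<epsilon> \<and> \<epsilon> \<le> \<epsilon>\<^sub>0 \<longrightarrow> (\<exists>n\<^sub>0. \<forall>n\<ge>n\<^sub>0. \<forall>A :: bool local_alg.
          approx_min_dominating_set \<epsilon> n A \<longrightarrow> real (rounds A n) \<ge> c * (ln (real n) / \<epsilon>))))"
proof -
  have wrap: "\<exists>\<epsilon>\<^sub>0 c :: real. 0 < \<epsilon>\<^sub>0 \<and> \<epsilon>\<^sub>0 < 1 \<and> 0 < c \<and> (\<forall>\<epsilon>. 0 < \<epsilon> \<and> \<epsilon> \<le> \<epsilon>\<^sub>0 \<longrightarrow> P c \<epsilon>)"
    if "\<And>\<epsilon>. 0 < \<epsilon> \<Longrightarrow> \<epsilon> \<le> 1 / 10000 \<Longrightarrow> P (1 / 100000) \<epsilon>" for P :: "real \<Rightarrow> real \<Rightarrow> bool"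
    by (rule exI[of _ "1 / 10000"], rule exI[of _ "1 / 100000"]) (use that in simp)
  show ?thesis
  proof (intro conjI wrap)
    fix \<epsilon> :: real assume "0 < \<epsilon>" "\<epsilon> \<le> 1 / 10000"
    note lower = round_lower_bound[OF this]
    show "\<exists>n\<^sub>0. \<forall>n\<ge>n\<^sub>0. \<forall>A :: bool local_alg.
        approx_max_independent_set \<epsilon> n A \<longrightarrow> 1 / 100000 * (ln (real n) / \<epsilon>) \<le> real (rounds A n)"
      using lower by (meson not_le)
    show "\<exists>n\<^sub>0. \<forall>n\<ge>n\<^sub>0. \<forall>A :: (nat \<Rightarrow> bool) local_alg.
        approx_max_cut \<epsilon> n A \<longrightarrow> 1 / 100000 * (ln (real n) / \<epsilon>) \<le> real (rounds A n)"
      using lower by (meson not_le)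
    show "\<exists>n\<^sub>0. \<forall>n\<ge>n\<^sub>0. \<forall>A :: bool local_alg.
        approx_min_vertex_cover \<epsilon> n A \<longrightarrow> 1 / 100000 * (ln (real n) / \<epsilon>) \<le> real (rounds A n)"
      using lower by (meson not_le)
    show "\<exists>n\<^sub>0. \<forall>n\<ge>n\<^sub>0. \<forall>A :: bool local_alg.
        approx_min_dominating_set \<epsilon> n A \<longrightarrow> 1 / 100000 * (ln (real n) / \<epsilon>) \<le> real (rounds A n)"
      using lower by (meson not_le)
  qed
qed

end
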